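(* If $0<\rho\le1$, $0\le\delta<1$, $\delta\le\rho$ and $a\in APS^0_{\rho,\delta}$, then $a(x,D)$, considered as an operator on $B^2(\mathbb R^d)$, is not compact unless it is zero.
   Context: Notation: $\langle\xi\rangle=(1+|\xi|^2)^{1/2}$, $e_\lambda(x)=e^{2\pi i\lambda\cdot x}$. $TP(\mathbb R^d)$: finite linear combinations of the $e_\lambda$, $\lambda\in\mathbb R^d$. $C_{\rm ap}(\mathbb R^d)$: uniform limits of trigonometric polynomials. Mean value $\mathscr M(f)=\lim_{T\to\infty}T^{-d}\int_{[0,T]^d}f(x)\,dx$. $B^2(\mathbb R^d)$: completion of $C_{\rm ap}(\mathbb R^d)$ for $(f,g)_B=\mathscr M(f\overline g)$. $APS^0_{\rho,\delta}$ is the set of $a\in C^\infty(\mathbb R^{2d})$ such that $a(\cdot,\xi)\in C_{\rm ap}(\mathbb R^d)$ for all $\xi$ and $\sup_{x,\xi}\langle\xi\rangle^{\rho|\alpha|-\delta|\beta|}|\partial_\xi^\alpha\partial_x^\beta a(x,\xi)|<\infty$ for all multi-indices $\alpha,\beta$. $a(x,D)$ acts on $TP(\mathbb R^d)$ by $a(x,D)e_\lambda=a(\cdot,\lambda)e_\lambda$; for $a\in APS^0_{\rho,\delta}$ it extends to a bounded operator on $B^2(\mathbb R^d)$. *)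

theory Defs
  imports "HOL-Analysis.Analysis"
begin

section \<open>Almost periodic functions and their mean value\<close>

definition echar :: "real ^ 'n::finite \<Rightarrow> real ^ 'n \<Rightarrow> complex" where
  "echar \<omega> x = exp (2 * of_real pi * \<i> * of_real (\<omega> \<bullet> x))"

definition TP :: "(real ^ 'n::finite \<Rightarrow> complex) set" where
  "TP = {f. \<exists>S c. finite S \<and> f = (\<lambda>x. \<Sum>\<omega>\<in>S. c \<omega> * echar \<omega> x)}"

definition Cap :: "(real ^ 'n::finite \<Rightarrow> complex) set" where
  "Cap = {f. \<exists>p. (\<forall>k. p k \<in> TP) \<and> uniform_limit UNIV p f sequentially}"

definition mean_over :: "real \<Rightarrow> (real ^ 'n::finite \<Rightarrow> complex) \<Rightarrow> complex" where
  "mean_over T f = integral (cbox 0 (\<chi> i. T)) f /\<^sub>R T ^ CARD('n)"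

definition mean_value :: "(real ^ 'n::finite \<Rightarrow> complex) \<Rightarrow> complex" where
  "mean_value f = Lim at_top (\<lambda>T. mean_over T f)"

lemma echar_cis: "echar \<omega> x = cis (2 * pi * (\<omega> \<bullet> x))"
  by (simp add: echar_def cis_conv_exp mult_ac)

lemma norm_echar [simp]: "norm (echar \<omega> x) = 1"
  by (simp add: echar_cis)

lemma echar_0 [simp]: "echar 0 x = 1"
  by (simp add: echar_def)

lemma echar_add: "echar (\<omega> + \<mu>) x = echar \<omega> x * echar \<mu> x"
  by (simp add: echar_cis cis_mult inner_add_left distrib_left)

lemma cnj_echar: "cnj (echar \<omega> x) = echar (- \<omega>) x"
  by (simp add: echar_cis cis_cnj)

lemma continuous_on_echar [continuous_intros]: "continuous_on A (echar \<omega>)"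
  unfolding echar_def[abs_def] by (intro continuous_intros)

lemma echar_in_TP: "echar \<omega> \<in> TP"
  unfolding TP_def by (auto intro!: exI[of _ "{\<omega>}"] exI[of _ "\<lambda>_. 1"])

lemma TP_induct [consumes 1, case_names zero add]:
  assumes "f \<in> TP" "P (\<lambda>x. 0)"
    and "\<And>c \<omega> g. g \<in> TP \<Longrightarrow> P g \<Longrightarrow> P (\<lambda>x. c * echar \<omega> x + g x)"
  shows "P f"
proof -
  obtain S c where S: "finite S" and f: "f = (\<lambda>x. \<Sum>\<omega>\<in>S. c \<omega> * echar \<omega> x)"
    using assms(1) by (auto simp: TP_def)
  have "P (\<lambda>x. \<Sum>\<omega>\<in>S. c \<omega> * echar \<omega> x)"
    using S
  proof (induction S)
    case (insert \<omega> S)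
    moreover have "(\<lambda>x. \<Sum>\<omega>\<in>S. c \<omega> * echar \<omega> x) \<in> TP"
      using insert.hyps by (auto simp: TP_def)
    ultimately show ?case using assms(3) by simp
  qed (simp add: assms(2))
  then show ?thesis using f by simp
qed

lemma TP_0: "(\<lambda>x. 0) \<in> TP"
  by (auto simp: TP_def intro!: exI[of _ "{}"])

lemma TP_add_echar:
  assumes "g \<in> TP" shows "(\<lambda>x. c * echar \<omega> x + g x) \<in> TP"
proof -
  obtain S d where S: "finite S" and g: "g = (\<lambda>x. \<Sum>\<omega>\<in>S. d \<omega> * echar \<omega> x)"
    using assms by (auto simp: TP_def)
  let ?d = "\<lambda>\<mu>. (if \<mu> = \<omega> then c else 0) + (if \<mu> \<in> S then d \<mu> else 0)"
  have "c * echar \<omega> x + g x = (\<Sum>\<mu>\<in>insert \<omega> S. ?d \<mu> * echar \<mu> x)" for x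
  proof -
    have "(\<Sum>\<mu>\<in>insert \<omega> S. ?d \<mu> * echar \<mu> x)
        = (\<Sum>\<mu>\<in>insert \<omega> S. if \<mu> = \<omega> then c * echar \<mu> x else 0)
          + (\<Sum>\<mu>\<in>insert \<omega> S. if \<mu> \<in> S then d \<mu> * echar \<mu> x else 0)"
      by (subst sum.distrib [symmetric], rule sum.cong) (auto simp: distrib_right)
    also have "(\<Sum>\<mu>\<in>insert \<omega> S. if \<mu> = \<omega> then c * echar \<mu> x else 0) = c * echar \<omega> x"
      using S by (subst sum.delta) auto
    also have "(\<Sum>\<mu>\<in>insert \<omega> S. if \<mu> \<in> S then d \<mu> * echar \<mu> x else 0) = g x"
      unfolding g using S by (intro sum.mono_neutral_cong_right) auto
    finally show ?thesis by simp
  qed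
  then show ?thesis unfolding TP_def using S
    by (intro CollectI exI[of _ "insert \<omega> S"] exI[of _ ?d]) auto
qed

lemma TP_add: "f \<in> TP \<Longrightarrow> g \<in> TP \<Longrightarrow> (\<lambda>x. f x + g x) \<in> TP"
proof (induction rule: TP_induct)
  case (add c \<omega> h)
  then show ?case using TP_add_echar[of "\<lambda>x. h x + g x" c \<omega>] by (simp add: add.assoc)
qed simp

lemma TP_cmult: "f \<in> TP \<Longrightarrow> (\<lambda>x. a * f x) \<in> TP"
proof (induction rule: TP_induct)
  case (add c \<omega> h)
  then show ?case using TP_add_echar[of "\<lambda>x. a * h x" "a * c" \<omega>] by (simp add: algebra_simps)
qed (simp add: TP_0)

lemma TP_cnj: "f \<in> TP \<Longrightarrow> (\<lambda>x. cnj (f x)) \<in> TP"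
proof (induction rule: TP_induct)
  case (add c \<omega> h)
  then show ?case using TP_add_echar[of "\<lambda>x. cnj (h x)" "cnj c" "-\<omega>"] by (simp add: cnj_echar)
qed (simp add: TP_0)

lemma TP_mult_echar: "f \<in> TP \<Longrightarrow> (\<lambda>x. echar \<mu> x * f x) \<in> TP"
proof (induction rule: TP_induct)
  case (add c \<omega> h)
  then show ?case using TP_add_echar[of "\<lambda>x. echar \<mu> x * h x" c "\<mu> + \<omega>"]
    by (simp add: algebra_simps echar_add)
qed (simp add: TP_0)

lemma TP_mult: "f \<in> TP \<Longrightarrow> g \<in> TP \<Longrightarrow> (\<lambda>x. f x * g x) \<in> TP"
proof (induction rule: TP_induct)
  case (add c \<omega> h)
  then show ?case
    using TP_add[OF TP_cmult[OF TP_mult_echar[of g \<omega>], of c], of "\<lambda>x. h x * g x"]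
    by (simp add: algebra_simps)
qed (simp add: TP_0)

lemma TP_bounded: "f \<in> TP \<Longrightarrow> bounded (range f)"
proof (induction rule: TP_induct)
  case (add c \<omega> g)
  have "bounded (range (\<lambda>x. c * echar \<omega> x))"
    by (auto simp: bounded_iff norm_mult)
  then show ?case using bounded_plus_comp[OF _ add.IH] by auto
qed (auto simp: bounded_iff)

lemma TP_continuous: "f \<in> TP \<Longrightarrow> continuous_on UNIV f"
  by (induction rule: TP_induct) (auto intro!: continuous_intros)

lemma CapI: "(\<And>k. p k \<in> TP) \<Longrightarrow> uniform_limit UNIV p f sequentially \<Longrightarrow> f \<in> Cap"
  by (auto simp: Cap_def)

lemma CapE:
  assumes "f \<in> Cap"
  obtains p where "\<And>k. p k \<in> TP" "uniform_limit UNIV p f sequentially"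
  using assms by (auto simp: Cap_def)

lemma TP_subset_Cap: "TP \<subseteq> Cap"
proof
  fix f :: "real ^ 'n \<Rightarrow> complex" assume "f \<in> TP"
  then show "f \<in> Cap" by (intro CapI[of "\<lambda>_. f"]) (auto simp: uniform_limit_iff)
qed

lemma Cap_bounded: assumes "f \<in> Cap" shows "bounded (range f)"
proof -
  from assms obtain p where "\<forall>k. p k \<in> TP" "uniform_limit UNIV p f sequentially"
    by (auto simp: Cap_def)
  then have p: "\<And>k. p k \<in> TP" "uniform_limit UNIV p f sequentially" by auto
  then obtain k where k: "\<forall>x. dist (p k x) (f x) < 1"
    using uniform_limitD[OF p(2), of 1] by (auto simp: eventually_sequentially)
  obtain B where B: "\<And>x. norm (p k x) \<le> B"
    using TP_bounded[OF p(1)[of k]] by (auto simp: bounded_iff)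
  have "norm (f x) \<le> B + 1" for x
  proof -
    have "norm (f x) \<le> norm (p k x) + norm (f x - p k x)" by norm
    moreover have "norm (f x - p k x) < 1" using k by (metis dist_commute dist_norm)
    ultimately show ?thesis using B[of x] by linarith
  qed
  then show ?thesis by (auto simp: bounded_iff)
qed

lemma Cap_continuous: "f \<in> Cap \<Longrightarrow> continuous_on UNIV f"
  by (elim CapE, rule uniform_limit_theorem[rotated]) (auto intro!: always_eventually TP_continuous)

lemma Cap_add: "f \<in> Cap \<Longrightarrow> g \<in> Cap \<Longrightarrow> (\<lambda>x. f x + g x) \<in> Cap"
proof (elim CapE)
  fix p q assume "\<And>k. p k \<in> TP" "\<And>k. q k \<in> TP"
    "uniform_limit UNIV p f sequentially" "uniform_limit UNIV q g sequentially"
  then show ?thesis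
    by (intro CapI[of "\<lambda>k x. p k x + q k x"] uniform_limit_add) (auto intro!: TP_add)
qed

lemma Cap_mult: assumes "f \<in> Cap" "g \<in> Cap" shows "(\<lambda>x. f x * g x) \<in> Cap"
  using assms
proof (elim CapE)
  fix p q assume "\<And>k. p k \<in> TP" "\<And>k. q k \<in> TP"
    "uniform_limit UNIV p f sequentially" "uniform_limit UNIV q g sequentially"
  then show ?thesis using Cap_bounded[OF assms(1)] Cap_bounded[OF assms(2)]
    by (intro CapI[of "\<lambda>k x. p k x * q k x"] uniform_lim_mult) (auto intro!: TP_mult)
qed

lemma Cap_cnj: "f \<in> Cap \<Longrightarrow> (\<lambda>x. cnj (f x)) \<in> Cap"
proof (elim CapE)
  fix p assume "\<And>k. p k \<in> TP" "uniform_limit UNIV p f sequentially"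
  then show ?thesis
    by (intro CapI[of "\<lambda>k x. cnj (p k x)"] bounded_linear.uniform_limit[OF bounded_linear_cnj])
      (auto intro!: TP_cnj)
qed

lemma Cap_const: "(\<lambda>x. c) \<in> Cap"
  using TP_cmult[OF echar_in_TP[of 0], of c] TP_subset_Cap by auto

lemma Cap_echar: "echar \<omega> \<in> Cap"
  using echar_in_TP TP_subset_Cap by blast

lemma Cap_cmult: "f \<in> Cap \<Longrightarrow> (\<lambda>x. c * f x) \<in> Cap"
  by (rule Cap_mult[OF Cap_const])

lemma Cap_diff: "f \<in> Cap \<Longrightarrow> g \<in> Cap \<Longrightarrow> (\<lambda>x. f x - g x) \<in> Cap"
  using Cap_add[OF _ Cap_cmult[of g "-1"]] by simp

lemma measure_cube:
  "T \<ge> 0 \<Longrightarrow> measure lborel (cbox 0 (\<chi> i. T) :: (real ^ 'n::finite) set) = T ^ CARD('n)"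
  by (subst content_cbox_cart) (auto simp: interval_eq_empty_cart not_less)

lemma integral_echar_prod:
  fixes \<omega> :: "real ^ 'n::finite"
  shows "integral (cbox 0 (\<chi> i. T)) (echar \<omega>)
       = (\<Prod>b\<in>Basis. integral {0..T} (\<lambda>t. cis (2 * pi * (\<omega> \<bullet> b) * t)))"
proof -
  let ?g = "\<lambda>b t. indicator {0..T} t *\<^sub>R cis (2 * pi * (\<omega> \<bullet> b) * t)"
  let ?C = "cbox 0 (\<chi> i. T) :: (real ^ 'n) set"
  interpret product_sigma_finite "\<lambda>b::real^'n. lborel :: real measure" ..
  have int: "set_integrable lborel {0..T} (\<lambda>t. cis (2 * pi * c * t))" for c
    by (intro borel_integrable_atLeastAtMost') (intro continuous_intros)
  have intC: "set_integrable lborel ?C (echar \<omega>)"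
    unfolding set_integrable_def
    by (intro borel_integrable_compact continuous_on_echar compact_cbox)
  have eq: "indicator ?C (\<Sum>b\<in>Basis. f b *\<^sub>R b) *\<^sub>R echar \<omega> (\<Sum>b\<in>Basis. f b *\<^sub>R b)
      = (\<Prod>b\<in>Basis. ?g b (f b))" for f :: "real ^ 'n \<Rightarrow> real"
  proof -
    let ?x = "\<Sum>b\<in>Basis. f b *\<^sub>R b"
    have x: "?x \<bullet> b = f b" if "b \<in> Basis" for b
      using that by simp
    have one: "(\<chi> i. T) \<bullet> b = T" if "b \<in> Basis" for b :: "real ^ 'n"
      using that by (auto simp: Basis_vec_def inner_axis)
    have e: "echar \<omega> ?x = (\<Prod>b\<in>Basis. cis (2 * pi * (\<omega> \<bullet> b) * f b))"
    proof -
      have "echar \<omega> ?x = exp (\<Sum>b\<in>Basis. \<i> * complex_of_real (2 * pi * (\<omega> \<bullet> b) * f b))"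
        unfolding echar_cis cis_conv_exp inner_sum_right
        by (simp add: sum_distrib_left mult_ac)
      then show ?thesis by (simp add: exp_sum cis_conv_exp)
    qed
    show ?thesis
    proof (cases "?x \<in> ?C")
      case True
      then have "indicator {0..T} (f b) = (1::real)" if "b \<in> Basis" for b
        using that x[OF that] one[OF that] by (auto simp: mem_box dest!: bspec[OF _ that])
      then show ?thesis using True e by simp
    next
      case False
      then obtain b where b: "b \<in> Basis" "f b \<notin> {0..T}"
        unfolding mem_box by (auto simp: x one not_le)
      then have "(\<Prod>b\<in>Basis. ?g b (f b)) = 0"
        by (intro prod_zero bexI[of _ b]) auto
      then show ?thesis using False by simp
    qed
  qed
  have "integral ?C (echar \<omega>) = (\<integral>x. indicator ?C x *\<^sub>R echar \<omega> x \<partial>lborel)"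
    using set_borel_integral_eq_integral(2)[OF intC] by (simp add: set_lebesgue_integral_def)
  also have "\<dots> = (\<integral>f. (\<Prod>b\<in>Basis. ?g b (f b)) \<partial>Pi\<^sub>M Basis (\<lambda>b. lborel))"
    by (subst lborel_eq, subst integral_distr)
       (use intC in \<open>auto simp: eq set_integrable_def\<close>)
  also have "\<dots> = (\<Prod>b\<in>Basis. \<integral>t. ?g b t \<partial>lborel)"
    using int by (intro product_integral_prod) (auto simp: set_integrable_def)
  also have "\<dots> = (\<Prod>b\<in>Basis. integral {0..T} (\<lambda>t. cis (2 * pi * (\<omega> \<bullet> b) * t)))"
    using set_borel_integral_eq_integral(2)[OF int]
    by (intro prod.cong) (auto simp: set_lebesgue_integral_def)
  finally show ?thesis .
qed

lemma norm_integral_cis_le: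
  assumes "T \<ge> 0" shows "norm (integral {0..T} (\<lambda>t. cis (c * t))) \<le> T"
proof -
  have "continuous_on {0..T} (\<lambda>t. cis (c * t))" by (intro continuous_intros)
  then show ?thesis using integral_bound[of 0 T "\<lambda>t. cis (c * t)" 1] assms by simp
qed

lemma norm_integral_cis_le':
  assumes "T \<ge> 0" "c \<noteq> 0" shows "norm (integral {0..T} (\<lambda>t. cis (c * t))) \<le> 2 / \<bar>c\<bar>"
proof -
  have "((\<lambda>t. cis (c * t)) has_integral (cis (c * T) / (\<i> * c) - cis (c * 0) / (\<i> * c))) {0..T}"
  proof (rule fundamental_theorem_of_calculus)
    fix t :: real
    have "((\<lambda>z. exp (\<i> * c * z) / (\<i> * c)) has_field_derivative exp (\<i> * c * of_real t)) (at (of_real t))"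
      using assms by (auto intro!: derivative_eq_intros)
    from has_vector_derivative_real_field[OF this]
    show "((\<lambda>t. cis (c * t) / (\<i> * c)) has_vector_derivative cis (c * t)) (at t within {0..T})"
      by (simp add: cis_conv_exp mult_ac)
  qed (use assms in auto)
  then have "integral {0..T} (\<lambda>t. cis (c * t)) = (cis (c * T) - 1) / (\<i> * c)"
    by (simp add: integral_unique diff_divide_distrib)
  moreover have "norm (cis (c * T) - 1) \<le> 2"
    using norm_triangle_ineq4[of "cis (c * T)" 1] by simp
  ultimately show ?thesis
    by (simp add: norm_divide norm_mult divide_right_mono)
qed

lemma Cap_integrable: "f \<in> Cap \<Longrightarrow> f integrable_on cbox a b"
  by (meson Cap_continuous continuous_on_subset integrable_continuous subset_UNIV)

lemma mean_over_add:
  "f \<in> Cap \<Longrightarrow> g \<in> Cap \<Longrightarrow> mean_over T (\<lambda>x. f x + g x) = mean_over T f + mean_over T g"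
  by (simp add: mean_over_def integral_add Cap_integrable scaleR_add_right)

lemma mean_over_cmult: "mean_over T (\<lambda>x. c * f x) = c * mean_over T f"
  by (simp add: mean_over_def)

lemma mean_over_cnj: "mean_over T (\<lambda>x. cnj (f x)) = cnj (mean_over T f)"
  by (simp add: mean_over_def integral_cnj)

lemma norm_mean_over_le:
  fixes f :: "real ^ 'n::finite \<Rightarrow> complex"
  assumes "f \<in> Cap" "\<And>x. norm (f x) \<le> B" "T > 0"
  shows "norm (mean_over T f) \<le> B"
proof -
  have B: "B \<ge> 0" using assms(2)[of 0] norm_ge_zero order_trans by blast
  have "norm (integral (cbox 0 (\<chi> i. T)) f) \<le> B * T ^ CARD('n)"
    using has_integral_bound[OF B integrable_integral[OF Cap_integrable[OF assms(1)]], of 0 "\<chi> i. T"]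
      assms(2,3) by (simp add: measure_cube)
  then show ?thesis using assms(3)
    by (simp add: mean_over_def field_simps)
qed

lemma tendsto_mean_echar:
  fixes \<omega> :: "real ^ 'n::finite"
  shows "((\<lambda>T. mean_over T (echar \<omega>)) \<longlongrightarrow> (if \<omega> = 0 then 1 else 0)) at_top"
proof (cases "\<omega> = 0")
  case True
  have "\<forall>\<^sub>F T in at_top. mean_over T (echar \<omega>) = 1"
    using eventually_gt_at_top[of 0]
    by eventually_elim (simp add: True mean_over_def echar_def[abs_def] measure_cube scaleR_conv_of_real)
  then show ?thesis using True by (simp add: tendsto_eventually)
next
  case False
  then obtain b where b: "b \<in> Basis" "\<omega> \<bullet> b \<noteq> 0"
    using euclidean_all_zero_iff by blast
  define c where "c = 2 * pi * (\<omega> \<bullet> b)"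
  have c: "c \<noteq> 0" using b by (simp add: c_def)
  have "\<forall>\<^sub>F T in at_top. norm (mean_over T (echar \<omega>)) \<le> 2 / \<bar>c\<bar> / T"
    using eventually_gt_at_top[of 0]
  proof eventually_elim
    case (elim T)
    let ?I = "\<lambda>b. integral {0..T} (\<lambda>t. cis (2 * pi * (\<omega> \<bullet> b) * t))"
    have "norm (integral (cbox 0 (\<chi> i. T)) (echar \<omega>)) = norm (?I b) * (\<Prod>b\<in>Basis - {b}. norm (?I b))"
      using b by (simp add: integral_echar_prod norm_mult prod.remove prod_norm)
    also have "\<dots> \<le> 2 / \<bar>c\<bar> * (\<Prod>b\<in>Basis - {b}. T)"
      using elim c
      by (intro mult_mono prod_mono conjI norm_integral_cis_le)
         (auto simp: c_def intro!: norm_integral_cis_le' prod_nonneg)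
    also have "(\<Prod>b\<in>Basis - {b}. T) = T ^ CARD('n) / T"
      using b elim by (simp add: card_Diff_singleton power_diff)
    finally show ?case using elim by (simp add: mean_over_def field_simps)
  qed
  moreover have "((\<lambda>T. 2 / \<bar>c\<bar> / T) \<longlongrightarrow> 0) at_top"
    by (intro tendsto_divide_0[OF tendsto_const] filterlim_at_top_imp_at_infinity filterlim_ident)
  ultimately show ?thesis using False by (simp add: Lim_null_comparison)
qed

lemma TP_mean_exists: "f \<in> TP \<Longrightarrow> \<exists>m. ((\<lambda>T. mean_over T f) \<longlongrightarrow> m) at_top"
proof (induction rule: TP_induct)
  case zero
  show ?case by (auto simp: mean_over_def intro!: exI[of _ 0])
next
  case (add c \<omega> g)
  then obtain m where m: "((\<lambda>T. mean_over T g) \<longlongrightarrow> m) at_top" by blast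
  have eq: "mean_over T (\<lambda>x. c * echar \<omega> x + g x) = c * mean_over T (echar \<omega>) + mean_over T g" for T
    using add.hyps TP_subset_Cap
    by (subst mean_over_add) (auto intro!: Cap_cmult Cap_echar simp: mean_over_cmult)
  have "((\<lambda>T. c * mean_over T (echar \<omega>) + mean_over T g) \<longlongrightarrow> c * (if \<omega> = 0 then 1 else 0) + m) at_top"
    by (intro tendsto_add tendsto_mult tendsto_const m tendsto_mean_echar)
  then show ?case unfolding eq by blast
qed

lemma uniform_limit_mean_over:
  fixes f :: "real ^ 'n::finite \<Rightarrow> complex"
  assumes "\<And>k. p k \<in> Cap" "f \<in> Cap" "uniform_limit UNIV p f sequentially"
  shows "uniform_limit {0<..} (\<lambda>k T. mean_over T (p k)) (\<lambda>T. mean_over T f) sequentially"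
proof (rule uniform_limitI)
  fix e :: real assume e: "e > 0"
  from uniform_limitD[OF assms(3), of "e/2"] e
  have "\<forall>\<^sub>F k in sequentially. \<forall>x. dist (p k x) (f x) < e / 2" by simp
  then show "\<forall>\<^sub>F k in sequentially. \<forall>T\<in>{0<..}. dist (mean_over T (p k)) (mean_over T f) < e"
  proof eventually_elim
    case (elim k)
    have "dist (mean_over T (p k)) (mean_over T f) < e" if "T > 0" for T
    proof -
      have "mean_over T (\<lambda>x. p k x - f x) = mean_over T (p k) - mean_over T f"
        using mean_over_add[OF assms(1)[of k] Cap_cmult[OF assms(2), of "-1"], of T]
        by (simp add: mean_over_cmult[of T "-1", simplified])
      moreover have "norm (mean_over T (\<lambda>x. p k x - f x)) \<le> e / 2"
        using elim that
        by (intro norm_mean_over_le Cap_diff assms) (auto simp: dist_norm less_imp_le)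
      ultimately show ?thesis using e by (simp add: dist_norm)
    qed
    then show ?case by simp
  qed
qed

lemma Cap_mean_exists:
  assumes "f \<in> Cap" shows "\<exists>m. ((\<lambda>T. mean_over T f) \<longlongrightarrow> m) at_top"
proof -
  from assms obtain p where "\<forall>k. p k \<in> TP" "uniform_limit UNIV p f sequentially"
    by (auto simp: Cap_def)
  then have p: "\<And>k. p k \<in> TP" "uniform_limit UNIV p f sequentially" by auto
  have pC: "\<And>k. p k \<in> Cap" using p(1) TP_subset_Cap by blast
  obtain m where m: "\<And>k. ((\<lambda>T. mean_over T (p k)) \<longlongrightarrow> m k) at_top"
    using TP_mean_exists[OF p(1)] by metis
  note ul = uniform_limit_mean_over[OF pC assms p(2)]
  have "Cauchy m"
  proof (rule metric_CauchyI)
    fix e :: real assume e: "e > 0"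
    from uniform_limitD[OF ul, of "e/3"] e obtain K where
      K: "\<And>k T. k \<ge> K \<Longrightarrow> T > 0 \<Longrightarrow> dist (mean_over T (p k)) (mean_over T f) < e / 3"
      by (auto simp: eventually_sequentially)
    have "dist (m i) (m j) < e" if "i \<ge> K" "j \<ge> K" for i j
    proof -
      have "dist (m i) (m j) \<le> 2 * e / 3"
      proof (rule tendsto_upperbound[OF tendsto_dist[OF m m]])
        show "\<forall>\<^sub>F T in at_top. dist (mean_over T (p i)) (mean_over T (p j)) \<le> 2 * e / 3"
          using eventually_gt_at_top[of 0]
        proof eventually_elim
          case (elim T)
          then show ?case using K[OF that(1) elim] K[OF that(2) elim]
              dist_triangle2[of "mean_over T (p i)" "mean_over T (p j)" "mean_over T f"] by linarith
        qed
      qed simp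
      then show ?thesis using e by linarith
    qed
    then show "\<exists>M. \<forall>i\<ge>M. \<forall>j\<ge>M. dist (m i) (m j) < e" by blast
  qed
  then obtain l where "m \<longlonglongrightarrow> l" using Cauchy_convergent_iff convergent_def by blast
  then have "((\<lambda>T. mean_over T f) \<longlongrightarrow> l) at_top"
    using m by (intro swap_uniform_limit'[OF _ _ ul]) (auto simp: eventually_gt_at_top)
  then show ?thesis ..
qed

lemma tendsto_mean_value:
  assumes "f \<in> Cap" shows "((\<lambda>T. mean_over T f) \<longlongrightarrow> mean_value f) at_top"
  using Cap_mean_exists[OF assms] unfolding mean_value_def by (metis tendsto_Lim trivial_limit_at_top_linorder)

lemma mean_valueI:
  "f \<in> Cap \<Longrightarrow> ((\<lambda>T. mean_over T f) \<longlongrightarrow> m) at_top \<Longrightarrow> mean_value f = m"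
  using tendsto_mean_value tendsto_unique trivial_limit_at_top_linorder by blast

lemma mean_value_add:
  "f \<in> Cap \<Longrightarrow> g \<in> Cap \<Longrightarrow> mean_value (\<lambda>x. f x + g x) = mean_value f + mean_value g"
  by (intro mean_valueI Cap_add)
     (auto simp: mean_over_add intro!: tendsto_add tendsto_mean_value)

lemma mean_value_cmult: "f \<in> Cap \<Longrightarrow> mean_value (\<lambda>x. c * f x) = c * mean_value f"
  by (intro mean_valueI Cap_cmult)
     (auto simp: mean_over_cmult intro!: tendsto_mult tendsto_mean_value)

lemma mean_value_cnj: "f \<in> Cap \<Longrightarrow> mean_value (\<lambda>x. cnj (f x)) = cnj (mean_value f)"
  by (intro mean_valueI Cap_cnj)
     (auto simp: mean_over_cnj intro!: tendsto_cnj tendsto_mean_value)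

lemma norm_mean_value_le:
  assumes "f \<in> Cap" "\<And>x. norm (f x) \<le> B"
  shows "norm (mean_value f) \<le> B"
proof (rule tendsto_upperbound[OF tendsto_norm[OF tendsto_mean_value[OF assms(1)]]])
  show "\<forall>\<^sub>F T in at_top. norm (mean_over T f) \<le> B"
    using eventually_gt_at_top[of 0] by eventually_elim (rule norm_mean_over_le[OF assms])
qed simp

lemma mean_value_nonneg:
  assumes f: "f \<in> Cap"
  shows "Re (mean_value (\<lambda>x. f x * cnj (f x))) \<ge> 0"
proof (rule tendsto_lowerbound[OF tendsto_Re[OF tendsto_mean_value]])
  show C: "(\<lambda>x. f x * cnj (f x)) \<in> Cap" by (intro Cap_mult Cap_cnj f)
  show "\<forall>\<^sub>F T in at_top. 0 \<le> Re (mean_over T (\<lambda>x. f x * cnj (f x)))"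
    using eventually_gt_at_top[of 0]
  proof eventually_elim
    case (elim T)
    have "((\<lambda>x. Re (f x * cnj (f x))) has_integral
        Re (integral (cbox 0 (\<chi> i. T)) (\<lambda>x. f x * cnj (f x)))) (cbox 0 (\<chi> i. T))"
      by (rule has_integral_Re[OF integrable_integral[OF Cap_integrable[OF C]]])
    then have "Re (integral (cbox 0 (\<chi> i. T)) (\<lambda>x. f x * cnj (f x))) \<ge> 0"
      by (rule has_integral_nonneg) simp
    then show ?case using elim by (simp add: mean_over_def)
  qed
qed simp

section \<open>The Besicovitch space\<close>

(* B2 is the completion of Cap for B_norm, constructed as the quotient of the space of Cauchy
   sequences by the null sequences. B2_of is the canonical map from Cap to B2; only its values on
   Cap are meaningful. That B2 is a completion is expressed by the class instance banach and by
   B2_of_add, B2_of_scale, norm_B2_of and closure_B2_of_Cap below. *)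

typedef ('n::finite) cap = "Cap :: (real ^ 'n \<Rightarrow> complex) set"
  morphisms cap_fun Abs_cap
  by (rule exI, rule Cap_echar)

setup_lifting type_definition_cap

instantiation cap :: (finite) real_vector
begin
lift_definition zero_cap :: "'a cap" is "\<lambda>_. 0" by (rule Cap_const)
lift_definition plus_cap :: "'a cap \<Rightarrow> 'a cap \<Rightarrow> 'a cap" is "\<lambda>f g x. f x + g x" by (rule Cap_add)
lift_definition minus_cap :: "'a cap \<Rightarrow> 'a cap \<Rightarrow> 'a cap" is "\<lambda>f g x. f x - g x" by (rule Cap_diff)
lift_definition uminus_cap :: "'a cap \<Rightarrow> 'a cap" is "\<lambda>f x. - f x"
  using Cap_cmult[of _ "-1"] by simp
lift_definition scaleR_cap :: "real \<Rightarrow> 'a cap \<Rightarrow> 'a cap" is "\<lambda>r f x. of_real r * f x"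
  by (rule Cap_cmult)
instance
  by standard (transfer, simp add: algebra_simps)+
end

lift_definition cap_scale :: "complex \<Rightarrow> 'n::finite cap \<Rightarrow> 'n cap" is "\<lambda>c f x. c * f x"
  by (rule Cap_cmult)

definition B_inner :: "'n::finite cap \<Rightarrow> 'n cap \<Rightarrow> complex" where
  "B_inner f g = mean_value (\<lambda>x. cap_fun f x * cnj (cap_fun g x))"

definition B_norm :: "'n::finite cap \<Rightarrow> real" where
  "B_norm f = sqrt (Re (B_inner f f))"

lemma cap_scale_of_real: "cap_scale (of_real r) f = r *\<^sub>R f"
  by transfer simp

lemma cap_scale_add: "cap_scale c (f + g) = cap_scale c f + cap_scale c g"
  and cap_scale_add_left: "cap_scale (c + d) f = cap_scale c f + cap_scale d f"
  and cap_scale_diff: "cap_scale c (f - g) = cap_scale c f - cap_scale c g"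
  and cap_scale_scale: "cap_scale c (cap_scale d f) = cap_scale (c * d) f"
  by (transfer, simp add: algebra_simps)+

lemma cap_fun_add: "cap_fun (f + g) x = cap_fun f x + cap_fun g x"
  by transfer simp

lemma cap_fun_scale: "cap_fun (cap_scale c f) x = c * cap_fun f x"
  by transfer simp

lemma cap_fun_in: "cap_fun f \<in> Cap"
  by (rule cap_fun)

lemma B_inner_in: "(\<lambda>x. cap_fun f x * cnj (cap_fun g x)) \<in> Cap"
  by (intro Cap_mult Cap_cnj cap_fun_in)

lemma B_inner_add_left: "B_inner (f + g) h = B_inner f h + B_inner g h"
  unfolding B_inner_def cap_fun_add distrib_right by (intro mean_value_add B_inner_in)

lemma B_inner_scale_left: "B_inner (cap_scale c f) h = c * B_inner f h"
  unfolding B_inner_def cap_fun_scale mult.assoc by (intro mean_value_cmult B_inner_in)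

lemma B_inner_commute: "B_inner g f = cnj (B_inner f g)"
  unfolding B_inner_def by (subst mean_value_cnj[symmetric]) (auto intro: B_inner_in simp: mult.commute)

lemma B_inner_add_right: "B_inner h (f + g) = B_inner h f + B_inner h g"
  by (metis B_inner_add_left B_inner_commute complex_cnj_add)

lemma B_inner_scale_right: "B_inner h (cap_scale c f) = cnj c * B_inner h f"
  by (metis B_inner_scale_left B_inner_commute complex_cnj_mult)

lemma B_inner_nonneg: "Re (B_inner f f) \<ge> 0"
  unfolding B_inner_def by (intro mean_value_nonneg cap_fun_in)

lemma B_norm_nonneg [simp]: "B_norm f \<ge> 0"
  by (simp add: B_norm_def B_inner_nonneg)

lemma B_norm_power2: "(B_norm f)\<^sup>2 = Re (B_inner f f)"
  by (simp add: B_norm_def B_inner_nonneg)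

lemma B_norm_scale: "B_norm (cap_scale c f) = norm c * B_norm f"
proof -
  have "B_inner (cap_scale c f) (cap_scale c f) = (c * cnj c) * B_inner f f"
    by (simp add: B_inner_scale_left B_inner_scale_right mult_ac)
  also have "c * cnj c = of_real ((norm c)\<^sup>2)"
    by (metis complex_norm_square of_real_power)
  finally show ?thesis
    by (simp add: B_norm_def real_sqrt_mult)
qed

lemma B_norm_scaleR [simp]: "B_norm (r *\<^sub>R f) = \<bar>r\<bar> * B_norm f"
  using B_norm_scale[of "of_real r" f] by (simp add: cap_scale_of_real)

lemma B_norm_minus [simp]: "B_norm (- f) = B_norm f"
  using B_norm_scaleR[of "-1" f] by simp

lemma B_norm_minus_commute: "B_norm (f - g) = B_norm (g - f)"
  using B_norm_minus[of "f - g"] by simp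

lemma B_norm_0 [simp]: "B_norm 0 = 0"
  using B_norm_scaleR[of 0 0] by simp

lemma B_norm_add_power2:
  "(B_norm (f + r *\<^sub>R g))\<^sup>2 = (B_norm f)\<^sup>2 + 2 * r * Re (B_inner f g) + r\<^sup>2 * (B_norm g)\<^sup>2"
proof -
  have "Re (B_inner g f) = Re (B_inner f g)"
    by (subst B_inner_commute) simp
  then show ?thesis
    unfolding B_norm_power2 cap_scale_of_real[symmetric]
    by (simp add: B_inner_add_left B_inner_add_right B_inner_scale_left B_inner_scale_right
        algebra_simps power2_eq_square)
qed

lemma B_cauchy_schwarz: "Re (B_inner f g) \<le> B_norm f * B_norm g"
proof (cases "B_norm g = 0")
  case True
  show ?thesis
  proof (rule ccontr)
    assume "\<not> ?thesis"
    then have pos: "Re (B_inner f g) > 0" using True by simp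
    define r where "r = - ((B_norm f)\<^sup>2 + 1) / (2 * Re (B_inner f g))"
    have "(B_norm (f + r *\<^sub>R g))\<^sup>2 = - 1"
      unfolding B_norm_add_power2 using pos True by (simp add: r_def field_simps)
    then show False using zero_le_power2[of "B_norm (f + r *\<^sub>R g)"] by linarith
  qed
next
  case False
  then have pos: "B_norm g > 0" using B_norm_nonneg[of g] by linarith
  define r where "r = - Re (B_inner f g) / (B_norm g)\<^sup>2"
  have "(B_norm (f + r *\<^sub>R g))\<^sup>2 = (B_norm f)\<^sup>2 - (Re (B_inner f g))\<^sup>2 / (B_norm g)\<^sup>2"
    unfolding B_norm_add_power2 using pos by (simp add: r_def field_simps power2_eq_square)
  then have "(Re (B_inner f g))\<^sup>2 / (B_norm g)\<^sup>2 \<le> (B_norm f)\<^sup>2"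
    using zero_le_power2[of "B_norm (f + r *\<^sub>R g)"] by linarith
  then have "(Re (B_inner f g))\<^sup>2 \<le> (B_norm f * B_norm g)\<^sup>2"
    using pos by (simp add: field_simps)
  then show ?thesis by (rule power2_le_imp_le) simp
qed

lemma B_norm_triangle: "B_norm (f + g) \<le> B_norm f + B_norm g"
proof (rule power2_le_imp_le)
  have "(B_norm (f + g))\<^sup>2 = (B_norm f)\<^sup>2 + 2 * Re (B_inner f g) + (B_norm g)\<^sup>2"
    using B_norm_add_power2[of f 1 g] by simp
  also have "\<dots> \<le> (B_norm f + B_norm g)\<^sup>2"
    using B_cauchy_schwarz[of f g] by (simp add: power2_sum)
  finally show "(B_norm (f + g))\<^sup>2 \<le> (B_norm f + B_norm g)\<^sup>2" .
qed simp

lemma B_norm_triangle_diff: "B_norm (f - h) \<le> B_norm (f - g) + B_norm (g - h)"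
  using B_norm_triangle[of "f - g" "g - h"] by simp

lemma B_norm_abs_diff: "\<bar>B_norm f - B_norm g\<bar> \<le> B_norm (f - g)"
  using B_norm_triangle[of "f - g" g] B_norm_triangle[of "g - f" f] B_norm_minus_commute[of f g]
  by simp

definition B_Cauchy :: "(nat \<Rightarrow> 'n::finite cap) \<Rightarrow> bool" where
  "B_Cauchy X \<longleftrightarrow> (\<forall>e>0. \<exists>N. \<forall>m\<ge>N. \<forall>n\<ge>N. B_norm (X m - X n) < e)"

definition B_equiv :: "(nat \<Rightarrow> 'n::finite cap) \<Rightarrow> (nat \<Rightarrow> 'n cap) \<Rightarrow> bool" where
  "B_equiv X Y \<longleftrightarrow> B_Cauchy X \<and> B_Cauchy Y \<and> (\<lambda>k. B_norm (X k - Y k)) \<longlonglongrightarrow> 0"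

lemma B_Cauchy_add:
  assumes "B_Cauchy X" "B_Cauchy Y" shows "B_Cauchy (\<lambda>k. X k + Y k)"
  unfolding B_Cauchy_def
proof (intro allI impI)
  fix e :: real assume "e > 0"
  then have "e / 2 > 0" by simp
  then obtain M N where M: "\<And>m n. m \<ge> M \<Longrightarrow> n \<ge> M \<Longrightarrow> B_norm (X m - X n) < e / 2"
    and N: "\<And>m n. m \<ge> N \<Longrightarrow> n \<ge> N \<Longrightarrow> B_norm (Y m - Y n) < e / 2"
    using assms unfolding B_Cauchy_def by meson
  have "B_norm (X m + Y m - (X n + Y n)) < e" if "m \<ge> max M N" "n \<ge> max M N" for m n
  proof -
    have eq: "X m + Y m - (X n + Y n) = (X m - X n) + (Y m - Y n)" by simp
    have "B_norm (X m - X n) < e / 2" "B_norm (Y m - Y n) < e / 2"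
      using M[of m n] N[of m n] that by simp_all
    then show ?thesis
      unfolding eq using B_norm_triangle[of "X m - X n" "Y m - Y n"] by linarith
  qed
  then show "\<exists>N. \<forall>m\<ge>N. \<forall>n\<ge>N. B_norm (X m + Y m - (X n + Y n)) < e" by blast
qed

lemma B_Cauchy_scale:
  assumes "B_Cauchy X" shows "B_Cauchy (\<lambda>k. cap_scale c (X k))"
  unfolding B_Cauchy_def
proof (intro allI impI)
  fix e :: real assume "e > 0"
  then have "e / (norm c + 1) > 0" by (simp add: add_nonneg_pos)
  then obtain N where N: "\<And>m n. m \<ge> N \<Longrightarrow> n \<ge> N \<Longrightarrow> B_norm (X m - X n) < e / (norm c + 1)"
    using assms unfolding B_Cauchy_def by meson
  have "B_norm (cap_scale c (X m) - cap_scale c (X n)) < e" if "m \<ge> N" "n \<ge> N" for m n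
  proof -
    have p: "norm c + 1 > 0" by (simp add: add_nonneg_pos)
    have "B_norm (cap_scale c (X m) - cap_scale c (X n)) \<le> (norm c + 1) * B_norm (X m - X n)"
      by (simp add: cap_scale_diff[symmetric] B_norm_scale mult_right_mono)
    also have "\<dots> < e" using N[OF that] p by (simp add: field_simps)
    finally show ?thesis .
  qed
  then show "\<exists>N. \<forall>m\<ge>N. \<forall>n\<ge>N. B_norm (cap_scale c (X m) - cap_scale c (X n)) < e" by blast
qed

lemma B_Cauchy_const: "B_Cauchy (\<lambda>_. f)"
  by (auto simp: B_Cauchy_def)

lemma B_Cauchy_norm_tendsto:
  assumes "B_Cauchy X" shows "(\<lambda>k. B_norm (X k)) \<longlonglongrightarrow> lim (\<lambda>k. B_norm (X k))"
proof -
  have "Cauchy (\<lambda>k. B_norm (X k))"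
  proof (rule metric_CauchyI)
    fix e :: real assume "e > 0"
    then obtain N where N: "\<forall>m\<ge>N. \<forall>n\<ge>N. B_norm (X m - X n) < e"
      using assms unfolding B_Cauchy_def by blast
    then show "\<exists>N. \<forall>m\<ge>N. \<forall>n\<ge>N. dist (B_norm (X m)) (B_norm (X n)) < e"
      by (metis B_norm_abs_diff dist_real_def order_le_less_trans)
  qed
  then show ?thesis by (simp add: Cauchy_convergent_iff convergent_LIMSEQ_iff)
qed

lemma B_equiv_add:
  assumes "B_equiv X X'" "B_equiv Y Y'"
  shows "B_equiv (\<lambda>k. X k + Y k) (\<lambda>k. X' k + Y' k)"
proof -
  have "(\<lambda>k. B_norm (X k + Y k - (X' k + Y' k))) \<longlonglongrightarrow> 0"
  proof (rule tendsto_sandwich[of "\<lambda>_. 0" _ _ "\<lambda>k. B_norm (X k - X' k) + B_norm (Y k - Y' k)"])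
    show "\<forall>\<^sub>F k in sequentially. B_norm (X k + Y k - (X' k + Y' k)) \<le> B_norm (X k - X' k) + B_norm (Y k - Y' k)"
      using B_norm_triangle[of "X k - X' k" "Y k - Y' k" for k] by (simp add: algebra_simps)
    show "(\<lambda>k. B_norm (X k - X' k) + B_norm (Y k - Y' k)) \<longlonglongrightarrow> 0"
      using tendsto_add[of _ 0 _ _ 0] assms unfolding B_equiv_def by force
  qed auto
  then show ?thesis using assms by (auto simp: B_equiv_def intro: B_Cauchy_add)
qed

lemma B_equiv_scale:
  assumes "B_equiv X X'" shows "B_equiv (\<lambda>k. cap_scale c (X k)) (\<lambda>k. cap_scale c (X' k))"
  using assms tendsto_mult_right_zero[of "\<lambda>k. B_norm (X k - X' k)" sequentially "norm c"]
  by (auto simp: B_equiv_def B_Cauchy_scale cap_scale_diff[symmetric] B_norm_scale)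

lemma B_equiv_part_equivp: "part_equivp (B_equiv :: (nat \<Rightarrow> 'n::finite cap) \<Rightarrow> _)"
proof (rule part_equivpI)
  show "\<exists>X. B_equiv X X" by (auto intro!: exI[of _ "\<lambda>_. 0"] simp: B_equiv_def B_Cauchy_const)
  show "symp B_equiv" by (auto simp: symp_def B_equiv_def B_norm_minus_commute)
  show "transp (B_equiv :: (nat \<Rightarrow> 'n cap) \<Rightarrow> _)"
  proof (rule transpI)
    fix X Y Z :: "nat \<Rightarrow> 'n cap" assume XY: "B_equiv X Y" and YZ: "B_equiv Y Z"
    have "(\<lambda>k. B_norm (X k - Z k)) \<longlonglongrightarrow> 0"
    proof (rule tendsto_sandwich[of "\<lambda>_. 0" _ _ "\<lambda>k. B_norm (X k - Y k) + B_norm (Y k - Z k)"])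
      show "(\<lambda>k. B_norm (X k - Y k) + B_norm (Y k - Z k)) \<longlonglongrightarrow> 0"
        using tendsto_add[of _ 0 _ _ 0] XY YZ unfolding B_equiv_def by force
    qed (auto simp: B_norm_triangle_diff)
    then show "B_equiv X Z" using XY YZ by (auto simp: B_equiv_def)
  qed
qed

quotient_type 'n B2 = "nat \<Rightarrow> ('n::finite) cap" / partial: B_equiv
  by (rule B_equiv_part_equivp)

lift_definition scaleB2 :: "complex \<Rightarrow> 'n::finite B2 \<Rightarrow> 'n B2" (infixr "*\<^sub>B" 75)
  is "\<lambda>c X k. cap_scale c (X k)" by (rule B_equiv_scale)

lemma B_equiv_refl: "B_equiv X X \<longleftrightarrow> B_Cauchy X"
  by (auto simp: B_equiv_def)

lemma B_equiv_eqI: "B_Cauchy X \<Longrightarrow> (\<And>k. X k = Y k) \<Longrightarrow> B_equiv X Y"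
  using B_equiv_refl[of X] by (metis ext)

lemma cap_scale_1 [simp]: "cap_scale 1 f = f" and cap_scale_0 [simp]: "cap_scale 0 f = 0"
  and cap_scale_minus_1: "cap_scale (- 1) f = - f"
  by (transfer, simp)+

instantiation B2 :: (finite) real_vector
begin

lift_definition zero_B2 :: "'a B2" is "\<lambda>_. 0"
  by (simp add: B_equiv_def B_Cauchy_const)

lift_definition plus_B2 :: "'a B2 \<Rightarrow> 'a B2 \<Rightarrow> 'a B2" is "\<lambda>X Y k. X k + Y k"
  by (rule B_equiv_add)

definition uminus_B2 :: "'a B2 \<Rightarrow> 'a B2" where "uminus_B2 u = (-1) *\<^sub>B u"
definition minus_B2 :: "'a B2 \<Rightarrow> 'a B2 \<Rightarrow> 'a B2" where "minus_B2 u v = u + - v"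
definition scaleR_B2 :: "real \<Rightarrow> 'a B2 \<Rightarrow> 'a B2" where "scaleR_B2 r u = of_real r *\<^sub>B u"

instance
proof
  fix u v w :: "'a B2" and r q :: real
  show "u + v + w = u + (v + w)"
    by transfer (auto simp: B_equiv_refl add.assoc intro!: B_equiv_eqI B_Cauchy_add)
  show "u + v = v + u"
    by transfer (auto simp: B_equiv_refl add.commute intro!: B_equiv_eqI B_Cauchy_add)
  show "0 + u = u"
    by transfer (auto simp: B_equiv_refl)
  show "- u + u = 0"
    unfolding uminus_B2_def
    by transfer (auto simp: cap_scale_minus_1 B_equiv_refl B_Cauchy_const)
  show "u - v = u + - v" by (rule minus_B2_def)
  show "r *\<^sub>R (u + v) = r *\<^sub>R u + r *\<^sub>R v"
    unfolding scaleR_B2_def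
    by transfer (auto simp: B_equiv_refl cap_scale_add intro!: B_equiv_eqI B_Cauchy_add B_Cauchy_scale)
  show "(r + q) *\<^sub>R u = r *\<^sub>R u + q *\<^sub>R u"
    unfolding scaleR_B2_def of_real_add
    by transfer (auto simp: B_equiv_refl cap_scale_add_left intro!: B_equiv_eqI B_Cauchy_add B_Cauchy_scale)
  show "r *\<^sub>R q *\<^sub>R u = (r * q) *\<^sub>R u"
    unfolding scaleR_B2_def of_real_mult
    by transfer (auto simp: B_equiv_refl cap_scale_scale intro!: B_equiv_eqI B_Cauchy_scale)
  show "1 *\<^sub>R u = u"
    unfolding scaleR_B2_def of_real_1
    by transfer (auto simp: B_equiv_refl)
qed

end

lemma lim_B_norm_cong:
  assumes "B_equiv X Y" shows "lim (\<lambda>k. B_norm (X k)) = lim (\<lambda>k. B_norm (Y k))"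
proof (rule limI)
  have C: "B_Cauchy Y" and XY: "(\<lambda>k. B_norm (X k - Y k)) \<longlonglongrightarrow> 0"
    using assms by (auto simp: B_equiv_def)
  have "(\<lambda>k. B_norm (X k) - B_norm (Y k)) \<longlonglongrightarrow> 0"
    by (rule Lim_null_comparison[OF _ XY]) (simp add: B_norm_abs_diff)
  from tendsto_add[OF this B_Cauchy_norm_tendsto[OF C]]
  show "(\<lambda>k. B_norm (X k)) \<longlonglongrightarrow> lim (\<lambda>k. B_norm (Y k))" by simp
qed

instantiation B2 :: (finite) real_normed_vector
begin

lift_definition norm_B2 :: "'a B2 \<Rightarrow> real" is "\<lambda>X. lim (\<lambda>k. B_norm (X k))"
  by (rule lim_B_norm_cong)

definition sgn_B2 :: "'a B2 \<Rightarrow> 'a B2" where "sgn_B2 u = u /\<^sub>R norm u"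
definition dist_B2 :: "'a B2 \<Rightarrow> 'a B2 \<Rightarrow> real" where "dist_B2 u v = norm (u - v)"
definition uniformity_B2 :: "('a B2 \<times> 'a B2) filter" where
  "uniformity_B2 = (INF e\<in>{0<..}. principal {(u, v). dist u v < e})"
definition open_B2 :: "'a B2 set \<Rightarrow> bool" where
  "open_B2 S \<longleftrightarrow> (\<forall>u\<in>S. \<forall>\<^sub>F (u', v) in uniformity. u' = u \<longrightarrow> v \<in> S)"

instance
proof
  fix u v :: "'a B2" and r :: real
  show "norm u = 0 \<longleftrightarrow> u = 0"
  proof (transfer, goal_cases)
    case (1 X)
    then have C: "B_Cauchy X" by (simp add: B_equiv_refl)
    have "lim (\<lambda>k. B_norm (X k)) = 0 \<longleftrightarrow> (\<lambda>k. B_norm (X k)) \<longlonglongrightarrow> 0"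
      using B_Cauchy_norm_tendsto[OF C] limI[of "\<lambda>k. B_norm (X k)" 0] by metis
    then show ?case by (simp add: B_equiv_def B_Cauchy_const C)
  qed
  show "norm (u + v) \<le> norm u + norm v"
  proof (transfer, goal_cases)
    case (1 X Y)
    then have C: "B_Cauchy X" "B_Cauchy Y" by (auto simp: B_equiv_refl)
    show ?case
      by (rule LIMSEQ_le[OF B_Cauchy_norm_tendsto[OF B_Cauchy_add[OF C]]
            tendsto_add[OF B_Cauchy_norm_tendsto[OF C(1)] B_Cauchy_norm_tendsto[OF C(2)]]])
         (auto intro: B_norm_triangle)
  qed
  show "norm (r *\<^sub>R u) = \<bar>r\<bar> * norm u"
    unfolding scaleR_B2_def
  proof (transfer, goal_cases)
    case (1 r X)
    then have "(\<lambda>k. B_norm (X k)) \<longlonglongrightarrow> lim (\<lambda>k. B_norm (X k))"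
      by (intro B_Cauchy_norm_tendsto) (simp add: B_equiv_refl)
    from tendsto_mult_left[OF this, of "\<bar>r\<bar>"] show ?case
      by (intro limI) (simp add: B_norm_scale)
  qed
qed (rule sgn_B2_def dist_B2_def uniformity_B2_def open_B2_def)+

end

definition cap_embed :: "'n::finite cap \<Rightarrow> 'n B2" where
  "cap_embed f = abs_B2 (\<lambda>_. f)"

definition B2_of :: "(real ^ 'n::finite \<Rightarrow> complex) \<Rightarrow> 'n B2" where
  "B2_of f = cap_embed (Abs_cap f)"

lemma cap_embed_add: "cap_embed (f + g) = cap_embed f + cap_embed g"
  by (simp add: cap_embed_def plus_B2.abs_eq B_equiv_refl B_Cauchy_const)

lemma cap_embed_scale: "cap_embed (cap_scale c f) = c *\<^sub>B cap_embed f"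
  by (simp add: cap_embed_def scaleB2.abs_eq B_equiv_refl B_Cauchy_const)

lemma cap_embed_diff: "cap_embed (f - g) = cap_embed f - cap_embed g"
  using cap_embed_add[of f "- g"] cap_embed_scale[of "-1" g]
  by (simp add: cap_scale_minus_1 minus_B2_def uminus_B2_def)

lemma norm_cap_embed: "norm (cap_embed f) = B_norm f"
  by (simp add: cap_embed_def norm_B2.abs_eq B_equiv_refl B_Cauchy_const)

lemma B_Cauchy_cap_embed: "B_Cauchy X \<longleftrightarrow> Cauchy (\<lambda>k. cap_embed (X k))"
  by (simp add: B_Cauchy_def Cauchy_def dist_norm cap_embed_diff[symmetric] norm_cap_embed)

lemma tendsto_abs_B2:
  assumes "B_Cauchy X" shows "(\<lambda>k. cap_embed (X k)) \<longlonglongrightarrow> abs_B2 X"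
proof (rule LIMSEQ_I)
  fix e :: real assume e: "e > 0"
  then have "e / 2 > 0" by simp
  then obtain N where N: "\<And>m n. m \<ge> N \<Longrightarrow> n \<ge> N \<Longrightarrow> B_norm (X m - X n) < e / 2"
    using assms unfolding B_Cauchy_def by meson
  have "norm (cap_embed (X k) - abs_B2 X) < e" if k: "k \<ge> N" for k
  proof -
    have C: "B_Cauchy (\<lambda>j. cap_scale (- 1) (X j))" by (rule B_Cauchy_scale[OF assms])
    have C': "B_Cauchy (\<lambda>j. X k + cap_scale (- 1) (X j))"
      by (intro B_Cauchy_add C B_Cauchy_const)
    have "cap_embed (X k) - abs_B2 X = abs_B2 (\<lambda>j. X k + cap_scale (- 1) (X j))"
      unfolding minus_B2_def uminus_B2_def cap_embed_def
      using assms C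
      by (simp add: scaleB2.abs_eq plus_B2.abs_eq B_equiv_refl B_Cauchy_const)
    also have "norm \<dots> = lim (\<lambda>j. B_norm (X k - X j))"
      using C' by (simp add: norm_B2.abs_eq B_equiv_refl cap_scale_minus_1)
    also have "\<dots> \<le> e / 2"
    proof (rule LIMSEQ_le_const2)
      show "(\<lambda>j. B_norm (X k - X j)) \<longlonglongrightarrow> lim (\<lambda>j. B_norm (X k - X j))"
        using B_Cauchy_norm_tendsto[OF C'] by (simp add: cap_scale_minus_1)
      show "\<exists>N. \<forall>j\<ge>N. B_norm (X k - X j) \<le> e / 2"
        using N[OF k] less_imp_le by blast
    qed
    finally show ?thesis using e by linarith
  qed
  then show "\<exists>N. \<forall>k\<ge>N. norm (cap_embed (X k) - abs_B2 X) < e" by blast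
qed

lemma B2_approx_sequence:
  obtains X where "B_Cauchy X" "(\<lambda>k. cap_embed (X k)) \<longlonglongrightarrow> u"
proof -
  have "B_Cauchy (rep_B2 u)"
    using Quotient_rep_reflp[OF Quotient_B2, of u] by (simp add: B_equiv_refl)
  moreover have "abs_B2 (rep_B2 u) = u"
    using Quotient_abs_rep[OF Quotient_B2] .
  ultimately show ?thesis using that tendsto_abs_B2 by metis
qed

lemma cap_embed_dense:
  assumes "e > 0" obtains f where "dist (cap_embed f) u < e"
proof -
  obtain X where "(\<lambda>k. cap_embed (X k)) \<longlonglongrightarrow> u" using B2_approx_sequence by blast
  then show ?thesis using assms that by (metis LIMSEQ_def order_refl)
qed

instance B2 :: (finite) banach
proof
  fix U :: "nat \<Rightarrow> 'a B2" assume U: "Cauchy U"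
  have "\<exists>f. dist (cap_embed f) (U k) < inverse (Suc k)" for k
    using cap_embed_dense[of "inverse (Suc k)" "U k"] by auto
  then obtain F where F: "\<And>k. dist (cap_embed (F k)) (U k) < inverse (Suc k)" by metis
  have null: "(\<lambda>k. cap_embed (F k) - U k) \<longlonglongrightarrow> 0"
    by (rule Lim_null_comparison[OF _ LIMSEQ_inverse_real_of_nat])
       (use F in \<open>auto simp: dist_norm less_imp_le\<close>)
  have "B_Cauchy F"
    unfolding B_Cauchy_cap_embed
  proof (rule metric_CauchyI)
    fix e :: real assume "e > 0"
    then have e: "e / 3 > 0" by simp
    obtain M where M: "\<And>m n. m \<ge> M \<Longrightarrow> n \<ge> M \<Longrightarrow> dist (U m) (U n) < e / 3"
      using metric_CauchyD[OF U e] by blast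
    obtain N where N: "\<And>k. k \<ge> N \<Longrightarrow> dist (cap_embed (F k)) (U k) < e / 3"
      using LIMSEQ_D[OF null e] by (auto simp: dist_norm)
    have "dist (cap_embed (F m)) (cap_embed (F n)) < e" if "m \<ge> max M N" "n \<ge> max M N" for m n
    proof -
      have "dist (U m) (U n) < e / 3" "dist (cap_embed (F m)) (U m) < e / 3"
        "dist (cap_embed (F n)) (U n) < e / 3"
        using that M N by auto
      then show ?thesis
        using dist_triangle[of "cap_embed (F m)" "cap_embed (F n)" "U m"]
          dist_triangle[of "U m" "cap_embed (F n)" "U n"]
          dist_commute[of "U n" "cap_embed (F n)"] by linarith
    qed
    then show "\<exists>K. \<forall>m\<ge>K. \<forall>n\<ge>K. dist (cap_embed (F m)) (cap_embed (F n)) < e" by blast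
  qed
  from tendsto_diff[OF tendsto_abs_B2[OF this] null]
  show "convergent U" by (auto simp: convergent_def)
qed

lemma B2_of_add: "f \<in> Cap \<Longrightarrow> g \<in> Cap \<Longrightarrow> B2_of (\<lambda>x. f x + g x) = B2_of f + B2_of g"
  by (simp add: B2_of_def cap_embed_add[symmetric] plus_cap.abs_eq eq_onp_same_args)

lemma B2_of_scale: "f \<in> Cap \<Longrightarrow> B2_of (\<lambda>x. c * f x) = c *\<^sub>B B2_of f"
  by (simp add: B2_of_def cap_embed_scale[symmetric] cap_scale.abs_eq eq_onp_same_args)

lemma norm_B2_of:
  "f \<in> Cap \<Longrightarrow> norm (B2_of f) = sqrt (Re (mean_value (\<lambda>x. f x * cnj (f x))))"
  by (simp add: B2_of_def norm_cap_embed B_norm_def B_inner_def Abs_cap_inverse)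

lemma closure_B2_of_Cap: "closure (B2_of ` Cap) = UNIV"
proof -
  have "u \<in> closure (B2_of ` Cap)" for u :: "'a B2"
    unfolding closure_approachable
  proof (intro allI impI)
    fix e :: real assume "e > 0"
    then obtain f where "dist (cap_embed f) u < e" by (rule cap_embed_dense)
    then show "\<exists>v\<in>B2_of ` Cap. dist v u < e"
      by (auto simp: B2_of_def cap_fun_inverse intro!: bexI[of _ "cap_fun f"] cap_fun_in)
  qed
  then show ?thesis by blast
qed

lemma vector_space_scaleB2: "vector_space (scaleB2 :: complex \<Rightarrow> 'n::finite B2 \<Rightarrow> 'n B2)"
proof
  fix c d :: complex and u v :: "'n B2"
  show "c *\<^sub>B (u + v) = c *\<^sub>B u + c *\<^sub>B v"
    by transfer (auto simp: B_equiv_refl cap_scale_add intro!: B_equiv_eqI B_Cauchy_add B_Cauchy_scale)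
  show "(c + d) *\<^sub>B u = c *\<^sub>B u + d *\<^sub>B u"
    by transfer (auto simp: B_equiv_refl cap_scale_add_left intro!: B_equiv_eqI B_Cauchy_add B_Cauchy_scale)
  show "c *\<^sub>B d *\<^sub>B u = (c * d) *\<^sub>B u"
    by transfer (auto simp: B_equiv_refl cap_scale_scale intro!: B_equiv_eqI B_Cauchy_scale)
  show "1 *\<^sub>B u = u"
    by transfer (auto simp: B_equiv_refl)
qed

lemma norm_scaleB2: "norm (c *\<^sub>B u) = norm c * norm u"
proof (transfer, goal_cases)
  case (1 c X)
  then have "(\<lambda>k. B_norm (X k)) \<longlonglongrightarrow> lim (\<lambda>k. B_norm (X k))"
    by (intro B_Cauchy_norm_tendsto) (simp add: B_equiv_refl)
  from tendsto_mult_left[OF this, of "norm c"] show ?case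
    by (intro limI) (simp add: B_norm_scale)
qed

lemma closure_B2_of_TP: "closure (B2_of ` TP) = (UNIV :: 'n::finite B2 set)"
proof -
  have "B2_of f \<in> closure (B2_of ` TP)" if f: "f \<in> Cap" for f :: "real ^ 'n \<Rightarrow> complex"
    unfolding closure_approachable
  proof (intro allI impI)
    fix e :: real assume "e > 0"
    obtain p where p: "\<forall>k. p k \<in> TP" "uniform_limit UNIV p f sequentially"
      using f by (auto simp: Cap_def)
    have "e / 2 > 0" using \<open>e > 0\<close> by simp
    from uniform_limitD[OF p(2) this] obtain k where k: "\<And>x. norm (p k x - f x) < e / 2"
      by (auto simp: eventually_sequentially dist_norm)
    define g where "g = (\<lambda>x. p k x - f x)"
    have pC: "p k \<in> Cap" using p(1) TP_subset_Cap by blast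
    have gC: "g \<in> Cap" unfolding g_def by (intro Cap_diff pC f)
    have "B2_of (p k) = B2_of g + B2_of f"
      using B2_of_add[OF gC f] by (simp add: g_def)
    then have "dist (B2_of (p k)) (B2_of f) = norm (B2_of g)" by (simp add: dist_norm)
    also have "\<dots> \<le> e / 2"
    proof -
      have "norm (g x * cnj (g x)) \<le> (e / 2)\<^sup>2" for x
      proof -
        have "norm (g x * cnj (g x)) = (norm (g x))\<^sup>2"
          by (simp only: norm_mult complex_mod_cnj power2_eq_square)
        also have "\<dots> \<le> (e / 2)\<^sup>2"
          unfolding g_def by (rule power_mono[OF less_imp_le[OF k] norm_ge_zero])
        finally show ?thesis .
      qed
      then have "norm (mean_value (\<lambda>x. g x * cnj (g x))) \<le> (e / 2)\<^sup>2"
        by (intro norm_mean_value_le Cap_mult Cap_cnj gC)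
      then have "Re (mean_value (\<lambda>x. g x * cnj (g x))) \<le> (e / 2)\<^sup>2"
        using complex_Re_le_cmod order_trans by blast
      then show ?thesis
        using \<open>e > 0\<close> unfolding norm_B2_of[OF gC] by (intro real_le_lsqrt) auto
    qed
    finally have "dist (B2_of (p k)) (B2_of f) < e" using \<open>e > 0\<close> by linarith
    then show "\<exists>v\<in>B2_of ` TP. dist v (B2_of f) < e" using p(1) by blast
  qed
  then have "B2_of ` Cap \<subseteq> closure (B2_of ` TP :: 'n B2 set)" by blast
  then have "closure (B2_of ` Cap) \<subseteq> closure (B2_of ` TP :: 'n B2 set)"
    by (rule closure_minimal) simp
  then show ?thesis using closure_B2_of_Cap by blast
qed

section \<open>Symbols\<close>

definition partial_deriv :: "'a::euclidean_space \<Rightarrow> ('a \<Rightarrow> complex) \<Rightarrow> 'a \<Rightarrow> complex" where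
  "partial_deriv b f x = frechet_derivative f (at x) b"

(* C_k k is membership in the class of k times continuously differentiable functions: total
   differentiability is required so that partial_deriv is meaningful. *)
primrec C_k :: "nat \<Rightarrow> ('a::euclidean_space \<Rightarrow> complex) \<Rightarrow> bool" where
  "C_k 0 f \<longleftrightarrow> continuous_on UNIV f"
| "C_k (Suc k) f \<longleftrightarrow> f differentiable_on UNIV \<and> (\<forall>b\<in>Basis. C_k k (partial_deriv b f))"

definition C_infinity :: "('a::euclidean_space \<Rightarrow> complex) \<Rightarrow> bool" where
  "C_infinity f \<longleftrightarrow> (\<forall>k. C_k k f)"

(* The multi-index derivative of order \<alpha> in the directions e i. The coordinates are taken in an
   arbitrary fixed order, which is immaterial for C_infinity functions. *)
definition multi_deriv ::
    "('n::finite \<Rightarrow> 'a::euclidean_space) \<Rightarrow> ('n \<Rightarrow> nat) \<Rightarrow> ('a \<Rightarrow> complex) \<Rightarrow> 'a \<Rightarrow> complex" where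
  "multi_deriv e \<alpha> f =
     foldr (\<lambda>i. partial_deriv (e i) ^^ \<alpha> i) (SOME is. distinct is \<and> set is = UNIV) f"

definition deriv_x ::
    "('n::finite \<Rightarrow> nat) \<Rightarrow> ((real ^ 'n) \<times> (real ^ 'n) \<Rightarrow> complex) \<Rightarrow> (real ^ 'n) \<times> (real ^ 'n) \<Rightarrow> complex" where
  "deriv_x \<beta> = multi_deriv (\<lambda>i. (axis i 1, 0)) \<beta>"

definition deriv_xi ::
    "('n::finite \<Rightarrow> nat) \<Rightarrow> ((real ^ 'n) \<times> (real ^ 'n) \<Rightarrow> complex) \<Rightarrow> (real ^ 'n) \<times> (real ^ 'n) \<Rightarrow> complex" where
  "deriv_xi \<alpha> = multi_deriv (\<lambda>i. (0, axis i 1)) \<alpha>"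

definition japanese :: "real ^ 'n::finite \<Rightarrow> real" where
  "japanese \<xi> = (1 + (norm \<xi>)\<^sup>2) powr (1 / 2)"

definition APS0 :: "real \<Rightarrow> real \<Rightarrow> ((real ^ 'n::finite) \<times> (real ^ 'n) \<Rightarrow> complex) set" where
  "APS0 \<rho> \<delta> = {a. C_infinity a \<and> (\<forall>\<xi>. (\<lambda>x. a (x, \<xi>)) \<in> Cap) \<and>
     (\<forall>\<alpha> \<beta>. bdd_above (range (\<lambda>(x, \<xi>).
        japanese \<xi> powr (\<rho> * real (sum \<alpha> UNIV) - \<delta> * real (sum \<beta> UNIV)) *
        norm (deriv_xi \<alpha> (deriv_x \<beta> a) (x, \<xi>)))))}"

section \<open>Operators on the Besicovitch space\<close>

definition bounded_operator :: "('n::finite B2 \<Rightarrow> 'n B2) \<Rightarrow> bool" where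
  "bounded_operator T \<longleftrightarrow> bounded_linear T \<and> (\<forall>c u. T (c *\<^sub>B u) = c *\<^sub>B T u)"

definition compact_operator :: "('n::finite B2 \<Rightarrow> 'n B2) \<Rightarrow> bool" where
  "compact_operator T \<longleftrightarrow> bounded_operator T \<and> (\<forall>S. bounded S \<longrightarrow> compact (closure (T ` S)))"

(* T is a(x,D) as an operator on B2: the bounded operator that agrees with a(x,D) on trigonometric
   polynomials. There is at most one such T, by psido_on_B2_unique below. *)
definition psido_on_B2 ::
    "((real ^ 'n::finite) \<times> (real ^ 'n) \<Rightarrow> complex) \<Rightarrow> ('n B2 \<Rightarrow> 'n B2) \<Rightarrow> bool" where
  "psido_on_B2 a T \<longleftrightarrow> bounded_operator T \<and>
     (\<forall>S c. finite S \<longrightarrow>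
        T (B2_of (\<lambda>x. \<Sum>\<omega>\<in>S. c \<omega> * echar \<omega> x)) =
        B2_of (\<lambda>x. \<Sum>\<omega>\<in>S. c \<omega> * (a (x, \<omega>) * echar \<omega> x)))"

lemma psido_on_B2_unique:
  assumes "psido_on_B2 a T" "psido_on_B2 a T'" shows "T = T'"
proof -
  have cont: "continuous_on UNIV T" "continuous_on UNIV T'"
    using assms by (auto simp: psido_on_B2_def bounded_operator_def linear_continuous_on)
  have "T u = T' u" if "u \<in> B2_of ` TP" for u
    using that assms by (fastforce simp: psido_on_B2_def TP_def)
  then have "closure (B2_of ` TP) \<subseteq> {u. T u = T' u}"
    by (intro closure_minimal closed_Collect_eq cont) auto
  then show ?thesis using closure_B2_of_TP by blast
qed

end

(* Let b = a(., \<lambda>0) be nonzero in B2. By almost periodicity the Fourier coefficients of |b|^2 at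
   frequencies close to but different from 0 are small, so the functions b e_\<lambda>, with \<lambda> near \<lambda>0, are
   uniformly separated in B2. Since the \<xi>-gradient of a is bounded, a(x,D) e_\<lambda> = a(., \<lambda>) e_\<lambda> is
   uniformly close to b e_\<lambda>. Hence a(x,D) maps the bounded set of all e_\<lambda> to a set containing
   an infinite uniformly separated sequence. *)
theory Submission
  imports Defs
begin

section \<open>Fourier coefficients of almost periodic functions\<close>

lemma mean_value_echar:
  "mean_value (echar \<omega> :: real ^ 'n::finite \<Rightarrow> complex) = (if \<omega> = 0 then 1 else 0)"
  by (rule mean_valueI[OF Cap_echar tendsto_mean_echar])

lemma mean_value_diff:
  assumes "f \<in> Cap" "g \<in> Cap"
  shows "mean_value (\<lambda>x. f x - g x) = mean_value f - mean_value g"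
  using mean_value_add[OF assms(1) Cap_cmult[OF assms(2), of "-1"]] mean_value_cmult[OF assms(2), of "-1"]
  by simp

text \<open>Multiplication by \<open>echar \<mu>\<close> shifts frequencies by \<mu>, so the mean
  survives only where a frequency is shifted to 0. The factor is not conjugated, hence
  \<open>F\<close> collects the negatives of the frequencies.\<close>

lemma TP_finite_spectrum:
  assumes "p \<in> TP"
  shows "\<exists>F. finite F \<and> (\<forall>\<mu>. \<mu> \<notin> F \<longrightarrow> mean_value (\<lambda>x. p x * echar \<mu> x) = 0)"
  using assms
proof (induction rule: TP_induct)
  case zero
  show ?case using mean_value_cmult[OF Cap_const, of 0 0] by (auto intro!: exI[of _ "{}"])
next
  case (add c \<omega> g)
  then obtain F where F: "finite F" "\<And>\<mu>. \<mu> \<notin> F \<Longrightarrow> mean_value (\<lambda>x. g x * echar \<mu> x) = 0"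
    by blast
  have "mean_value (\<lambda>x. (c * echar \<omega> x + g x) * echar \<mu> x) = 0" if "\<mu> \<notin> insert (- \<omega>) F" for \<mu>
  proof -
    have "\<omega> + \<mu> \<noteq> 0" using that by (auto simp: add_eq_0_iff2)
    have gC: "(\<lambda>x. g x * echar \<mu> x) \<in> Cap"
      using add.hyps TP_subset_Cap by (intro Cap_mult Cap_echar) auto
    have "(\<lambda>x. (c * echar \<omega> x + g x) * echar \<mu> x) = (\<lambda>x. c * echar (\<omega> + \<mu>) x + g x * echar \<mu> x)"
      by (simp add: echar_add algebra_simps)
    then show ?thesis
      using that \<open>\<omega> + \<mu> \<noteq> 0\<close> F(2)[of \<mu>]
      by (simp add: mean_value_add[OF Cap_cmult[OF Cap_echar] gC] mean_value_cmult[OF Cap_echar]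
          mean_value_echar)
  qed
  then show ?case using F(1) by (intro exI[of _ "insert (- \<omega>) F"]) auto
qed

text \<open>Replace \<open>f\<close> by a trigonometric polynomial within \<open>e\<close> in the
  sup norm: \<open>echar \<mu>\<close> has modulus 1 and means are bounded by the sup norm, so each
  coefficient changes by at most \<open>e\<close>.\<close>

lemma Cap_almost_finite_spectrum:
  assumes f: "f \<in> Cap" and e: "e > 0"
  obtains F where "finite F" "\<And>\<mu>. \<mu> \<notin> F \<Longrightarrow> norm (mean_value (\<lambda>x. f x * echar \<mu> x)) \<le> e"
proof -
  obtain p where p: "\<And>k. p k \<in> TP" "uniform_limit UNIV p f sequentially"
    using f by (rule CapE) blast
  obtain k where k: "\<And>x. norm (p k x - f x) < e"
    using uniform_limitD[OF p(2) e] by (auto simp: eventually_sequentially dist_norm)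
  obtain F where F: "finite F" "\<And>\<mu>. \<mu> \<notin> F \<Longrightarrow> mean_value (\<lambda>x. p k x * echar \<mu> x) = 0"
    using TP_finite_spectrum[OF p(1)] by metis
  have "norm (mean_value (\<lambda>x. f x * echar \<mu> x)) \<le> e" if "\<mu> \<notin> F" for \<mu>
  proof -
    have pC: "p k \<in> Cap" using p(1) TP_subset_Cap by blast
    have "mean_value (\<lambda>x. f x * echar \<mu> x - p k x * echar \<mu> x) = mean_value (\<lambda>x. f x * echar \<mu> x)"
      using F(2)[OF that] by (simp add: mean_value_diff Cap_mult Cap_echar f pC)
    moreover have "norm (mean_value (\<lambda>x. f x * echar \<mu> x - p k x * echar \<mu> x)) \<le> e"
    proof (rule norm_mean_value_le)
      show "norm (f x * echar \<mu> x - p k x * echar \<mu> x) \<le> e" for x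
        using k[of x] by (simp add: left_diff_distrib[symmetric] norm_mult norm_minus_commute less_imp_le)
    qed (intro Cap_diff Cap_mult Cap_echar f pC)
    ultimately show ?thesis by simp
  qed
  then show ?thesis using F(1) that by blast
qed

section \<open>Norms and distances of modulated functions in \<open>B2\<close>\<close>

lemma B2_of_diff: "f \<in> Cap \<Longrightarrow> g \<in> Cap \<Longrightarrow> B2_of (\<lambda>x. f x - g x) = B2_of f - B2_of g"
  using B2_of_add[OF Cap_diff[of f g], of g] by simp

lemma norm_B2_of_le:
  assumes f: "f \<in> Cap" and B: "\<And>x. norm (f x) \<le> B"
  shows "norm (B2_of f) \<le> B"
proof -
  have "norm (f x * cnj (f x)) \<le> B\<^sup>2" for x
    using power_mono[OF B norm_ge_zero, of x 2] by (simp add: norm_mult power2_eq_square)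
  then have "norm (mean_value (\<lambda>x. f x * cnj (f x))) \<le> B\<^sup>2"
    by (intro norm_mean_value_le Cap_mult Cap_cnj f)
  then have "Re (mean_value (\<lambda>x. f x * cnj (f x))) \<le> B\<^sup>2"
    using complex_Re_le_cmod order_trans by blast
  moreover have "B \<ge> 0" using B[of 0] norm_ge_zero order_trans by blast
  ultimately show ?thesis unfolding norm_B2_of[OF f] by (intro real_le_lsqrt) auto
qed

lemma echar_mult_cnj: "echar \<omega> x * cnj (echar \<mu> x) = echar (\<omega> - \<mu>) x"
  by (simp add: cnj_echar echar_add[symmetric])

lemma norm_B2_of_mult_echar:
  assumes "f \<in> Cap"
  shows "norm (B2_of (\<lambda>x. f x * echar \<omega> x)) = norm (B2_of f)"
proof -
  have "f x * echar \<omega> x * cnj (f x * echar \<omega> x) = f x * cnj (f x) * (echar \<omega> x * cnj (echar \<omega> x))" for x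
    by simp
  then have "f x * echar \<omega> x * cnj (f x * echar \<omega> x) = f x * cnj (f x)" for x
    by (simp only: echar_mult_cnj) simp
  then show ?thesis using assms by (simp only: norm_B2_of Cap_mult Cap_echar)
qed

text \<open>The squared distance is twice the squared norm of \<open>b\<close> minus the real parts
  of the coefficients of |b|^2 at \<omega> - \<mu> and \<mu> - \<omega>. Only finitely many
  coefficients are large, so a small ball around 0 meets no such frequency except 0 itself.\<close>

lemma modulations_separated:
  fixes b :: "real ^ 'n::finite \<Rightarrow> complex"
  assumes b: "b \<in> Cap" and nz: "B2_of b \<noteq> 0"
  obtains r where "r > 0" "\<And>\<omega> \<mu>. \<omega> \<noteq> \<mu> \<Longrightarrow> norm (\<omega> - \<mu>) < r \<Longrightarrow>
    norm (B2_of b) \<le> norm (B2_of (\<lambda>x. b x * echar \<omega> x) - B2_of (\<lambda>x. b x * echar \<mu> x))"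
proof -
  define f where "f = (\<lambda>x. b x * cnj (b x))"
  have fC: "f \<in> Cap" unfolding f_def by (intro Cap_mult Cap_cnj b)
  have M: "Re (mean_value f) = (norm (B2_of b))\<^sup>2"
    using mean_value_nonneg[OF b] by (simp add: norm_B2_of[OF b] f_def)
  \<comment> \<open>Half the squared norm as threshold: the two cross terms together then cost at
    most one of the two copies of it.\<close>
  have e: "(norm (B2_of b))\<^sup>2 / 2 > 0" using nz by simp
  obtain F where F: "finite F"
    "\<And>\<mu>. \<mu> \<notin> F \<Longrightarrow> norm (mean_value (\<lambda>x. f x * echar \<mu> x)) \<le> (norm (B2_of b))\<^sup>2 / 2"
    using Cap_almost_finite_spectrum[OF fC e] by blast
  \<comment> \<open>The frequency 0 belongs to \<open>F\<close>, since the mean of |b|^2 exceeds the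
    threshold; only the nonzero members can be kept away.\<close>
  obtain r where r: "r > 0" "\<And>\<mu>. \<mu> \<in> F \<Longrightarrow> \<mu> \<noteq> 0 \<Longrightarrow> r \<le> dist 0 \<mu>"
    using finite_set_avoid[OF F(1), of 0] by auto
  have "norm (B2_of b) \<le> norm (B2_of (\<lambda>x. b x * echar \<omega> x) - B2_of (\<lambda>x. b x * echar \<mu> x))"
    if ne: "\<omega> \<noteq> \<mu>" and small: "norm (\<omega> - \<mu>) < r" for \<omega> \<mu>
  proof -
    define g where "g = (\<lambda>x. b x * echar \<omega> x - b x * echar \<mu> x)"
    have gC: "g \<in> Cap" unfolding g_def by (intro Cap_diff Cap_mult Cap_echar b)
    have coeff: "Re (mean_value (\<lambda>x. f x * echar \<nu> x)) \<le> (norm (B2_of b))\<^sup>2 / 2"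
      if "\<nu> = \<omega> - \<mu> \<or> \<nu> = \<mu> - \<omega>" for \<nu>
    proof -
      have "\<nu> \<notin> F" using that r(2)[of \<nu>] ne small by (auto simp: norm_minus_commute)
      then show ?thesis using F(2) complex_Re_le_cmod order_trans by blast
    qed
    have one: "echar \<nu> x * cnj (echar \<nu> x) = 1" for \<nu> x :: "real ^ 'n"
      using echar_mult_cnj[of \<nu> x \<nu>] by simp
    \<comment> \<open>Each character is grouped with a conjugate one, so that each product collapses
      to a single character or to 1.\<close>
    have "g x * cnj (g x) = f x * (echar \<omega> x * cnj (echar \<omega> x)) + f x * (echar \<mu> x * cnj (echar \<mu> x))
        - f x * (echar \<omega> x * cnj (echar \<mu> x)) - f x * (echar \<mu> x * cnj (echar \<omega> x))" for x
      by (simp add: g_def f_def algebra_simps)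
    then have gg: "g x * cnj (g x) = f x + f x - f x * echar (\<omega> - \<mu>) x - f x * echar (\<mu> - \<omega>) x" for x
      by (simp only: one echar_mult_cnj mult_1_right)
    have "(norm (B2_of g))\<^sup>2 = Re (mean_value (\<lambda>x. g x * cnj (g x)))"
      using mean_value_nonneg[OF gC] by (simp add: norm_B2_of[OF gC])
    also have "\<dots> = 2 * (norm (B2_of b))\<^sup>2 - Re (mean_value (\<lambda>x. f x * echar (\<omega> - \<mu>) x))
        - Re (mean_value (\<lambda>x. f x * echar (\<mu> - \<omega>) x))"
      unfolding gg
      by (simp only: mean_value_diff mean_value_add Cap_diff Cap_add Cap_mult Cap_echar fC M
          minus_complex.sel plus_complex.sel mult_2)
    finally have "(norm (B2_of b))\<^sup>2 \<le> (norm (B2_of g))\<^sup>2"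
      using coeff[of "\<omega> - \<mu>"] coeff[of "\<mu> - \<omega>"] by simp
    then have "norm (B2_of b) \<le> norm (B2_of g)" by (rule power2_le_imp_le) simp
    then show ?thesis
      unfolding g_def by (simp add: B2_of_diff Cap_mult Cap_echar b)
  qed
  then show ?thesis using r(1) that by blast
qed

section \<open>Lipschitz dependence of the symbol on the frequency variable\<close>

lemma foldr_funpow_single:
  assumes "distinct is" "i \<in> set is"
  shows "foldr (\<lambda>j. D j ^^ (if j = i then 1 else 0)) is f = D i f"
proof -
  have "foldr (\<lambda>j. D j ^^ (if j = i then 1 else 0)) js f = f" if "i \<notin> set js" for js
    using that by (induction js) auto
  then show ?thesis using assms by (induction "is") auto
qed

lemma some_enumeration:
  "distinct (SOME is. distinct is \<and> set is = (UNIV :: 'n::finite set))"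
  "set (SOME is. distinct is \<and> set is = (UNIV :: 'n set)) = UNIV"
  using someI_ex[of "\<lambda>is. distinct is \<and> set is = (UNIV :: 'n set)"]
    finite_distinct_list[of "UNIV :: 'n set"] by auto

text \<open>In a unit multi-index every power but one is the identity, so the result is the same for
  whichever enumeration \<open>SOME\<close> picks.\<close>

lemma multi_deriv_single:
  fixes i :: "'n::finite"
  shows "multi_deriv e (\<lambda>j. if j = i then 1 else 0) f = partial_deriv (e i) f"
  unfolding multi_deriv_def
  by (rule foldr_funpow_single) (simp_all add: some_enumeration)

lemma multi_deriv_0:
  fixes e :: "'n::finite \<Rightarrow> 'a::euclidean_space"
  shows "multi_deriv e (\<lambda>_. 0) f = f"
proof -
  have "foldr (\<lambda>_ g. g) is f = f" for "is" :: "'n list" by (induction "is") auto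
  then show ?thesis by (simp add: multi_deriv_def id_def)
qed

lemma japanese_ge_1: "japanese \<xi> \<ge> 1"
  unfolding japanese_def by (rule ge_one_powr_ge_zero) auto

lemma APS0_deriv_xi_bounded:
  fixes i :: "'n::finite"
  assumes "a \<in> APS0 \<rho> \<delta>" "\<rho> \<ge> 0"
  obtains C where "\<And>x \<xi>. norm (partial_deriv (0, axis i 1) a (x, \<xi>)) \<le> C"
proof -
  let ?\<alpha> = "\<lambda>j. if j = i then 1 else (0::nat)"
  have "bdd_above (range (\<lambda>(x, \<xi>).
      japanese \<xi> powr (\<rho> * real (sum ?\<alpha> UNIV) - \<delta> * real (sum (\<lambda>_. 0::nat) (UNIV :: 'n set))) *
      norm (deriv_xi ?\<alpha> (deriv_x (\<lambda>_. 0) a) (x, \<xi>))))"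
    using assms(1) unfolding APS0_def mem_Collect_eq by (elim conjE allE)
  then have "bdd_above (range (\<lambda>(x, \<xi>). japanese \<xi> powr \<rho> * norm (partial_deriv (0, axis i 1) a (x, \<xi>))))"
    unfolding deriv_xi_def deriv_x_def multi_deriv_single multi_deriv_0 by simp
  then obtain C where C: "\<And>x \<xi>. japanese \<xi> powr \<rho> * norm (partial_deriv (0, axis i 1) a (x, \<xi>)) \<le> C"
    by (auto simp: bdd_above_def)
  have "norm (partial_deriv (0, axis i 1) a (x, \<xi>)) \<le> C" for x \<xi>
    using mult_right_mono[OF ge_one_powr_ge_zero[OF japanese_ge_1[of \<xi>] assms(2)],
        of "norm (partial_deriv (0, axis i 1) a (x, \<xi>))"] C[where x = x and \<xi> = \<xi>] by simp
  then show ?thesis by (rule that)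
qed

text \<open>Mean value inequality along a line in the i-th frequency direction; the constant is
  uniform in \<open>x\<close> and \<xi>.\<close>

lemma APS0_Lipschitz_xi:
  assumes a: "a \<in> APS0 \<rho> \<delta>" and "\<rho> \<ge> 0"
  obtains C where "C \<ge> 0" "\<And>x \<xi> t. norm (a (x, \<xi> + t *\<^sub>R axis i 1) - a (x, \<xi>)) \<le> C * \<bar>t\<bar>"
proof -
  obtain C where C: "\<And>x \<xi>. norm (partial_deriv (0, axis i 1) a (x, \<xi>)) \<le> C"
    using APS0_deriv_xi_bounded[OF assms] by blast
  \<comment> \<open>Order 1 of \<open>C_k\<close> contains total differentiability, which the chain
    rule along the line requires.\<close>
  have "C_k (Suc 0) a" using a by (auto simp: APS0_def C_infinity_def)
  then have D: "(a has_derivative frechet_derivative a (at z)) (at z)" for z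
    unfolding frechet_derivative_works[symmetric] C_k.simps differentiable_on_def by blast
  have "norm (a (x, \<xi> + t *\<^sub>R axis i 1) - a (x, \<xi>)) \<le> C * \<bar>t\<bar>" for x \<xi> t
  proof -
    let ?h = "\<lambda>s. a (x, \<xi> + s *\<^sub>R axis i 1)"
    have "(?h has_vector_derivative partial_deriv (0, axis i 1) a (x, \<xi> + s *\<^sub>R axis i 1)) (at s)" for s
    proof -
      let ?L = "frechet_derivative a (at (x, \<xi> + s *\<^sub>R axis i 1))"
      have "((\<lambda>s. (x, \<xi> + s *\<^sub>R axis i 1)) has_derivative (\<lambda>h. (0, h *\<^sub>R axis i 1))) (at s)"
        by (auto intro!: derivative_eq_intros)
      from has_derivative_compose[OF this D]
      have "(?h has_derivative (\<lambda>h. ?L (0, h *\<^sub>R axis i 1))) (at s)" .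
      moreover have "?L (0, h *\<^sub>R axis i 1) = h *\<^sub>R ?L (0, axis i 1)" for h
        using linear_scale[OF has_derivative_linear[OF D], of _ h "(0, axis i 1)"] by simp
      ultimately show ?thesis by (simp add: has_vector_derivative_def partial_deriv_def)
    qed
    then have "norm (?h t - ?h 0) \<le> C * norm (t - 0)"
      by (intro differentiable_bound[of UNIV ?h "\<lambda>s h. h *\<^sub>R partial_deriv (0, axis i 1) a (x, \<xi> + s *\<^sub>R axis i 1)"])
        (auto simp: has_vector_derivative_def C mult.commute[of C] mult_left_mono intro!: onorm_le)
    then show ?thesis by simp
  qed
  moreover have "C \<ge> 0" using C norm_ge_zero order_trans by blast
  ultimately show ?thesis using that by blast
qed

section \<open>Action on characters, vanishing, and compactness\<close>

lemma psido_on_B2_echar: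
  assumes "psido_on_B2 a T"
  shows "T (B2_of (echar \<omega>)) = B2_of (\<lambda>x. a (x, \<omega>) * echar \<omega> x)"
  using assms unfolding psido_on_B2_def
  by (auto dest!: spec[of _ "{\<omega>}"] spec[of _ "\<lambda>_. 1"])

text \<open>If every slice of the symbol vanished in \<open>B2\<close>, the zero operator would also
  realise a(x,D), and uniqueness would force \<open>T\<close> to be zero.\<close>

lemma psido_on_B2_nonzero:
  fixes a :: "(real ^ 'n::finite) \<times> (real ^ 'n) \<Rightarrow> complex"
  assumes aC: "\<And>\<xi>. (\<lambda>x. a (x, \<xi>)) \<in> Cap" and T: "psido_on_B2 a T" "T \<noteq> (\<lambda>u. 0)"
  obtains \<xi> where "B2_of (\<lambda>x. a (x, \<xi>)) \<noteq> 0"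
proof (rule ccontr)
  assume "\<not> thesis"
  then have 0: "B2_of (\<lambda>x. a (x, \<xi>)) = 0" for \<xi> using that by blast
  \<comment> \<open>Membership in \<open>Cap\<close> is carried through the induction because
    additivity of \<open>B2_of\<close> is available only there.\<close>
  have sum0: "(\<lambda>x. \<Sum>\<omega>\<in>S. c \<omega> * (a (x, \<omega>) * echar \<omega> x)) \<in> Cap \<and>
      B2_of (\<lambda>x. \<Sum>\<omega>\<in>S. c \<omega> * (a (x, \<omega>) * echar \<omega> x)) = 0"
    if "finite S" for S and c :: "real ^ 'n \<Rightarrow> complex"
    using that
  proof (induction S)
    case empty
    have "norm (B2_of (\<lambda>x. 0 :: complex) :: 'n B2) \<le> 0"
      by (rule norm_B2_of_le[OF Cap_const]) simp
    then show ?case by (simp add: Cap_const)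
  next
    case (insert \<omega> S)
    have C: "(\<lambda>x. a (x, \<omega>) * echar \<omega> x) \<in> Cap" by (intro Cap_mult aC Cap_echar)
    have "norm (B2_of (\<lambda>x. c \<omega> * (a (x, \<omega>) * echar \<omega> x))) = 0"
      unfolding B2_of_scale[OF C] norm_scaleB2 norm_B2_of_mult_echar[OF aC] 0 by simp
    then show ?case
      using insert Cap_add[OF Cap_cmult[OF C]] by (simp add: B2_of_add Cap_cmult C)
  qed
  have "psido_on_B2 a (\<lambda>u. 0)"
    unfolding psido_on_B2_def bounded_operator_def
  proof (intro conjI allI impI)
    show "0 = c *\<^sub>B (0 :: 'n B2)" for c
      using norm_scaleB2[of c "0 :: 'n B2"] by simp
  qed (use sum0 in auto)
  then show False using psido_on_B2_unique T by blast
qed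

text \<open>The images have a convergent, hence Cauchy, subsequence. Strict monotonicity of the
  selection makes two late indices distinct.\<close>

lemma compact_operator_not_separated:
  assumes "compact_operator T" "bounded (range u)" "d > 0"
  obtains m n :: nat where "m \<noteq> n" "dist (T (u m)) (T (u n)) < d"
proof -
  have "seq_compact (closure (T ` range u))"
    using assms by (simp add: compact_operator_def compact_imp_seq_compact)
  moreover have "\<forall>n. T (u n) \<in> closure (T ` range u)"
    by (intro allI subsetD[OF closure_subset] imageI rangeI)
  ultimately obtain l \<sigma> where "strict_mono (\<sigma> :: nat \<Rightarrow> nat)" "((\<lambda>n. T (u n)) \<circ> \<sigma>) \<longlonglongrightarrow> l"
    by (rule seq_compactE)
  then have "Cauchy (\<lambda>n. T (u (\<sigma> n)))"
    by (intro LIMSEQ_imp_Cauchy[of _ l]) (simp add: comp_def)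
  then obtain N where N: "\<And>m n. m \<ge> N \<Longrightarrow> n \<ge> N \<Longrightarrow> dist (T (u (\<sigma> m))) (T (u (\<sigma> n))) < d"
    using metric_CauchyD[OF _ \<open>d > 0\<close>] by blast
  have "\<sigma> N < \<sigma> (Suc N)"
    using \<open>strict_mono \<sigma>\<close> by (rule strict_monoD) simp
  then show ?thesis using N[of N "Suc N"] by (intro that[of "\<sigma> N" "\<sigma> (Suc N)"]) auto
qed

section \<open>Frequencies accumulating at a point where the symbol is nonzero\<close>

theorem corollary6p7:
  fixes a :: "(real ^ 'n::finite) \<times> (real ^ 'n) \<Rightarrow> complex"
    and T :: "'n B2 \<Rightarrow> 'n B2"
    and \<rho> \<delta> :: real
  assumes "0 < \<rho>" "\<rho> \<le> 1" "0 \<le> \<delta>" "\<delta> < 1" "\<delta> \<le> \<rho>"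
    and "a \<in> APS0 \<rho> \<delta>"
    and "psido_on_B2 a T"
    and "T \<noteq> (\<lambda>u. 0)"
  shows "\<not> compact_operator T"
proof
  assume comp: "compact_operator T"
  have aC: "(\<lambda>x. a (x, \<xi>)) \<in> Cap" for \<xi>
    using assms(6) by (auto simp: APS0_def)
  obtain \<xi> where nz: "B2_of (\<lambda>x. a (x, \<xi>)) \<noteq> 0"
    using psido_on_B2_nonzero[OF aC assms(7,8)] by blast
  define b where "b = (\<lambda>x. a (x, \<xi>))"
  define M where "M = norm (B2_of b)"
  have M: "M > 0" using nz by (simp add: M_def b_def)
  have bC: "b \<in> Cap" unfolding b_def by (rule aC)
  \<comment> \<open>Index types are inhabited, so there is a coordinate direction along which to
    move the frequency.\<close>
  fix i :: 'n
  obtain r where r: "r > 0" "\<And>\<omega> \<mu>. \<omega> \<noteq> \<mu> \<Longrightarrow> norm (\<omega> - \<mu>) < r \<Longrightarrow>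
      M \<le> norm (B2_of (\<lambda>x. b x * echar \<omega> x) - B2_of (\<lambda>x. b x * echar \<mu> x))"
    using modulations_separated[OF bC] nz unfolding M_def b_def by blast
  obtain C where C: "C \<ge> 0" "\<And>x \<xi> t. norm (a (x, \<xi> + t *\<^sub>R axis i 1) - a (x, \<xi>)) \<le> C * \<bar>t\<bar>"
    using APS0_Lipschitz_xi[OF assms(6)] assms(1) by (metis less_imp_le)
  \<comment> \<open>The first bound keeps the modulations separated, the second makes freezing the
    symbol at \<xi> cost at most \<open>M / 4\<close>. Adding 1 to \<open>C\<close> keeps the
    denominator positive when \<open>C\<close> is 0.\<close>
  define s where "s = min r (M / (4 * (C + 1)))"
  have s: "s > 0" "s \<le> r" using r(1) M C(1) by (auto simp: s_def)
  have "C * s \<le> C * (M / (4 * (C + 1)))" using C(1) by (intro mult_left_mono) (auto simp: s_def)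
  also have "\<dots> \<le> M / 4" using C(1) M by (simp add: field_simps)
  finally have Cs: "C * s \<le> M / 4" .
  \<comment> \<open>Distinct points of (0, s]: any two differ by strictly less than
    \<open>s\<close>, hence by less than \<open>r\<close>.\<close>
  define t where "t n = s / real (Suc n)" for n
  have t: "0 < t n" "t n \<le> s" for n using s by (auto simp: t_def field_simps)
  define \<kappa> where "\<kappa> n = \<xi> + t n *\<^sub>R axis i 1" for n
  have diff: "\<kappa> m - \<kappa> n = (t m - t n) *\<^sub>R axis i 1" for m n
    by (simp add: \<kappa>_def algebra_simps)
  have sep: "M \<le> norm (B2_of (\<lambda>x. b x * echar (\<kappa> m) x) - B2_of (\<lambda>x. b x * echar (\<kappa> n) x))"
    if "m \<noteq> n" for m n
  proof (rule r(2))
    have "t m \<noteq> t n" using that s(1) by (auto simp: t_def)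
    then show "\<kappa> m \<noteq> \<kappa> n" using diff[of m n] by (auto simp: axis_eq_0_iff)
    show "norm (\<kappa> m - \<kappa> n) < r"
      unfolding diff using t[of m] t[of n] s(2) by auto
  qed
  \<comment> \<open>Freezing the symbol at \<xi> is controlled in the sup norm, which dominates the
    norm of \<open>B2\<close>.\<close>
  have close: "norm (T (B2_of (echar (\<kappa> n))) - B2_of (\<lambda>x. b x * echar (\<kappa> n) x)) \<le> M / 4" for n
  proof -
    have "norm (a (x, \<kappa> n) * echar (\<kappa> n) x - b x * echar (\<kappa> n) x) \<le> M / 4" for x
    proof -
      have "norm (a (x, \<kappa> n) - b x) \<le> C * \<bar>t n\<bar>"
        unfolding b_def \<kappa>_def by (rule C(2))
      also have "\<dots> \<le> C * s" using t[of n] C(1) by (intro mult_left_mono) auto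
      finally show ?thesis using Cs by (simp add: left_diff_distrib[symmetric] norm_mult)
    qed
    then have "norm (B2_of (\<lambda>x. a (x, \<kappa> n) * echar (\<kappa> n) x - b x * echar (\<kappa> n) x)) \<le> M / 4"
      by (intro norm_B2_of_le Cap_diff Cap_mult aC bC Cap_echar)
    then show ?thesis
      by (simp add: psido_on_B2_echar[OF assms(7)] B2_of_diff Cap_mult aC bC Cap_echar)
  qed
  have "bounded (range (\<lambda>n. B2_of (echar (\<kappa> n))))"
    unfolding bounded_iff using norm_B2_of_le[OF Cap_echar, of _ 1] by auto
  \<comment> \<open>With two freezing errors of at most \<open>M / 4\<close>, images closer than
    \<open>M / 2\<close> would put two modulations of \<open>b\<close> at distance below
    \<open>M\<close>.\<close>
  moreover have "M / 2 > 0" using M by simp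
  ultimately obtain m n where "m \<noteq> n"
    and mn: "dist (T (B2_of (echar (\<kappa> m)))) (T (B2_of (echar (\<kappa> n)))) < M / 2"
    using compact_operator_not_separated[OF comp] by blast
  let ?f = "\<lambda>n. B2_of (\<lambda>x. b x * echar (\<kappa> n) x)"
  let ?g = "\<lambda>n. T (B2_of (echar (\<kappa> n)))"
  have "dist (?f m) (?f n) \<le> dist (?f m) (?g m) + dist (?g m) (?g n) + dist (?g n) (?f n)"
    using dist_triangle[of "?f m" "?f n" "?g m"] dist_triangle[of "?g m" "?f n" "?g n"] by linarith
  then show False
    using sep[OF \<open>m \<noteq> n\<close>] close[of m] close[of n] mn by (simp add: dist_norm norm_minus_commute)
qed

end
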